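(* Let $r:(0,\pi/2)\to\mathbb{R}_+$ be a non-decreasing function. Let $\gamma\in S(r)$ and let $H_\gamma$ be the operator on polynomials with vanishing derivatives at $0$ of order up to $\lfloor r(0)\rfloor$ defined by $$H_\gamma\Big(\sum_{n>r(0)}a_nz^n\Big)=\sum_{n>r(0)}\gamma(n)a_nz^n.$$ Let $U\subset\mathbb{C}$ be an open bounded domain, star-shaped with respect to $0$. Let $\delta>0$ and $U^\delta=\{z\in\mathbb{C}:\ \mathrm{distance}(z,U)<\delta\}$. Then there exists $C>0$ such that for all polynomials $f$ with vanishing derivatives at $0$ of order up to $\lfloor r(0)\rfloor$, $$|H_\gamma(f)|_{L^\infty(U)}\le C|f|_{L^\infty(U^\delta)}.$$ Moreover, the constant $C$ can be chosen continuously in $\gamma\in S(r)$: the map $\gamma\mapsto H_\gamma$ is continuous from $S(r)$ to $\mathcal{L}\big(\mathcal{O}^\infty_{r(0)}(U^\delta),\mathcal{O}^\infty_{r(0)}(U)\big)$.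
   Context: For a non-decreasing $r:(0,\pi/2)\to\mathbb{R}_+$ and $\theta\in(0,\pi/2)$, let $U_{\theta,r(\theta)}=\{z\in\mathbb{C}: |z|>r(\theta),\ |\arg(z)|<\theta\}$. $S(r)$ is the set of functions $\gamma:\bigcup_{\theta\in(0,\pi/2)}U_{\theta,r(\theta)}\to\mathbb{C}$ that are holomorphic and such that for each $\theta\in(0,\pi/2)$ and $\epsilon>0$, $p_{\theta,\epsilon}(\gamma):=\sup_{z\in U_{\theta,r(\theta)}}|\gamma(z)e^{-\epsilon|z|}|<+\infty$; it is endowed with the topology defined by the seminorms $p_{\theta,\epsilon}$. Set $r(0):=\inf_{\theta\in(0,\pi/2)}r(\theta)$. $\mathcal{O}_{r(0)}$ is the space of entire functions of the form $\sum_{n>r(0)}a_nz^n$, i.e. entire $f$ with $f^{(j)}(0)=0$ for all integers $0\le j\le r(0)$; $H_\gamma$ is extended to $\mathcal{O}_{r(0)}$ by the same formula. For an open bounded $V\subset\mathbb{C}$, $\mathcal{O}^\infty_{r(0)}(V)$ is the space $\mathcal{O}_{r(0)}$ endowed with the $L^\infty(V)$ norm. $\mathcal{L}(E,F)$ is the space of bounded linear operators from $E$ to $F$ with the operator norm. *)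

theory Defs
  imports "HOL-Complex_Analysis.Complex_Analysis" "HOL-Probability.Essential_Supremum"
begin

text \<open>A family \<open>P\<close> of seminorms on \<open>X\<close> induces the topology having the seminorm balls with
  centre in \<open>X\<close> as a subbase.\<close>

definition seminorm_topology :: "'v::minus set \<Rightarrow> ('v \<Rightarrow> real) set \<Rightarrow> 'v topology" where
  "seminorm_topology X P =
     topology_generated_by {{y \<in> X. p (y - x) < e} | p x e. p \<in> P \<and> x \<in> X \<and> 0 < e}"

definition sector :: "real \<Rightarrow> real \<Rightarrow> complex set" where
  "sector \<theta> \<rho> = {z. norm z > \<rho> \<and> \<bar>Arg z\<bar> < \<theta>}"

definition sector_union :: "(real \<Rightarrow> real) \<Rightarrow> complex set" where
  "sector_union r = (\<Union>\<theta>\<in>{0<..<pi/2}. sector \<theta> (r \<theta>))"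

definition seminorm_S :: "(real \<Rightarrow> real) \<Rightarrow> real \<Rightarrow> real \<Rightarrow> (complex \<Rightarrow> complex) \<Rightarrow> real" where
  "seminorm_S r \<theta> \<epsilon> \<gamma> =
     (SUP z\<in>sector \<theta> (r \<theta>). norm (\<gamma> z * of_real (exp (- \<epsilon> * norm z))))"

text \<open>A function on \<^term>\<open>sector_union r\<close> is represented by its extension by zero. Finiteness of
  the suprema is required explicitly, as the supremum of an unbounded set of reals is
  unspecified.\<close>

definition S_space :: "(real \<Rightarrow> real) \<Rightarrow> (complex \<Rightarrow> complex) set" where
  "S_space r = {\<gamma>. \<gamma> holomorphic_on sector_union r \<and> (\<forall>z. z \<notin> sector_union r \<longrightarrow> \<gamma> z = 0) \<and>
     (\<forall>\<theta>\<in>{0<..<pi/2}. \<forall>\<epsilon>>0.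
        bdd_above ((\<lambda>z. norm (\<gamma> z * of_real (exp (- \<epsilon> * norm z)))) ` sector \<theta> (r \<theta>)))}"

definition S_topology :: "(real \<Rightarrow> real) \<Rightarrow> (complex \<Rightarrow> complex) topology" where
  "S_topology r = seminorm_topology (S_space r)
     {seminorm_S r \<theta> \<epsilon> | \<theta> \<epsilon>. \<theta> \<in> {0<..<pi/2} \<and> 0 < \<epsilon>}"

definition r_zero :: "(real \<Rightarrow> real) \<Rightarrow> real" where
  "r_zero r = (INF \<theta>\<in>{0<..<pi/2}. r \<theta>)"

definition O_space :: "(real \<Rightarrow> real) \<Rightarrow> (complex \<Rightarrow> complex) set" where
  "O_space r = {f. f holomorphic_on UNIV \<and> (\<forall>j::nat. real j \<le> r_zero r \<longrightarrow> (deriv ^^ j) f 0 = 0)}"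

text \<open>The coefficient \<open>a\<^sub>n\<close> is the Taylor coefficient of \<open>f\<close> at the origin. Like every operator
  on \<^term>\<open>O_space r\<close> below, \<open>H_op r \<gamma>\<close> is extended by zero to all functions.\<close>

definition H_op :: "(real \<Rightarrow> real) \<Rightarrow> (complex \<Rightarrow> complex) \<Rightarrow> (complex \<Rightarrow> complex) \<Rightarrow> complex \<Rightarrow> complex"
  where
  "H_op r \<gamma> f = (if f \<in> O_space r
     then (\<lambda>z. \<Sum>n. if real n > r_zero r then \<gamma> (of_nat n) * ((deriv ^^ n) f 0 / fact n) * z ^ n else 0)
     else (\<lambda>_. 0))"

text \<open>The conversion to a real number is harmless: the norm is only applied to entire functions on
  nonempty bounded open sets, where the essential supremum is finite.\<close>

definition Linf_norm :: "complex set \<Rightarrow> (complex \<Rightarrow> complex) \<Rightarrow> real" where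
  "Linf_norm V f = real_of_ereal (esssup (lebesgue_on V) (\<lambda>z. ereal (norm (f z))))"

lemma Linf_norm_eq_SUP:
  assumes "open V" "bounded V" "V \<noteq> {}" "continuous_on UNIV f"
  shows "Linf_norm V f = (SUP z\<in>V. norm (f z))"
proof -
  let ?g = "\<lambda>z. norm (f z)" and ?M = "lebesgue_on V"
  have V: "V \<in> sets lebesgue" using assms(1) by simp
  have "compact (closure V)" using assms(2) by simp
  then have "bounded (f ` closure V)"
    by (meson assms(4) compact_continuous_image compact_imp_bounded continuous_on_subset subset_UNIV)
  then have bdd: "bdd_above (?g ` V)"
    unfolding bounded_iff by (meson bdd_aboveI2 closure_subset imageI subsetD)
  have cont: "continuous_on V ?g"
    using assms(4) by (intro continuous_intros) (auto intro: continuous_on_subset)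
  have "?g \<in> borel_measurable ?M"
    using cont V by (rule continuous_imp_measurable_on_sets_lebesgue)
  then have meas: "(\<lambda>z. ereal (?g z)) \<in> borel_measurable ?M" by simp
  have "esssup ?M (\<lambda>z. ereal (?g z)) = ereal (SUP z\<in>V. ?g z)"
  proof (rule antisym)
    show "esssup ?M (\<lambda>z. ereal (?g z)) \<le> ereal (SUP z\<in>V. ?g z)"
      using meas bdd V by (intro esssup_I) (auto intro!: AE_I2 cSUP_upper simp: space_restrict_space)
  next
    have le: "ereal (?g z) \<le> esssup ?M (\<lambda>z. ereal (?g z))" if z: "z \<in> V" for z
    proof (rule ccontr)
      assume "\<not> ?thesis"
      then have lt: "esssup ?M (\<lambda>z. ereal (?g z)) < ereal (?g z)" by simp
      then obtain c where c: "esssup ?M (\<lambda>z. ereal (?g z)) < ereal c" "c < ?g z"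
        using ereal_dense2 by (metis ereal_less_eq(3) less_ereal.simps(1))
      let ?A = "V \<inter> ?g -` {c<..}"
      have op: "open ?A" using cont assms(1) by (simp add: continuous_open_preimage)
      have "AE x in ?M. x \<notin> ?A"
        using esssup_AE[of "\<lambda>z. ereal (?g z)" ?M]
      proof eventually_elim
        case (elim x)
        then have "ereal (?g x) < ereal c" using c(1) by (rule le_less_trans)
        then show ?case by simp
      qed
      then have "AE x in lebesgue. x \<notin> ?A"
        using V by (simp add: AE_restrict_space_iff)
      then have "negligible ?A"
        using op by (simp add: AE_iff_null_sets negligible_iff_null_sets)
      then show False using open_not_negligible[OF op] z c(2) by auto
    qed
    obtain z0 where z0: "z0 \<in> V" using assms(3) by auto
    show "ereal (SUP z\<in>V. ?g z) \<le> esssup ?M (\<lambda>z. ereal (?g z))"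
    proof (cases "esssup ?M (\<lambda>z. ereal (?g z))")
      case (real c)
      then show ?thesis using le assms(3) by (auto intro!: cSUP_least)
    next
      case PInf then show ?thesis by simp
    next
      case MInf then show ?thesis using le[OF z0] by simp
    qed
  qed
  then show ?thesis by (simp add: Linf_norm_def)
qed

text \<open>Bounded linear operators from \<^term>\<open>O_space r\<close> with the norm \<^term>\<open>Linf_norm V\<close> to
  \<^term>\<open>O_space r\<close> with the norm \<^term>\<open>Linf_norm W\<close>, and their operator norm
  (the zero function contributes \<open>0 / 0 = 0\<close> to the supremum).\<close>

definition bounded_ops ::
  "(real \<Rightarrow> real) \<Rightarrow> complex set \<Rightarrow> complex set \<Rightarrow> ((complex \<Rightarrow> complex) \<Rightarrow> complex \<Rightarrow> complex) set" where
  "bounded_ops r V W = {T.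
     (\<forall>f\<in>O_space r. T f \<in> O_space r) \<and>
     (\<forall>f\<in>O_space r. \<forall>g\<in>O_space r. T (\<lambda>z. f z + g z) = (\<lambda>z. T f z + T g z)) \<and>
     (\<forall>c. \<forall>f\<in>O_space r. T (\<lambda>z. c * f z) = (\<lambda>z. c * T f z)) \<and>
     (\<forall>f. f \<notin> O_space r \<longrightarrow> T f = (\<lambda>_. 0)) \<and>
     (\<exists>K. \<forall>f\<in>O_space r. Linf_norm W (T f) \<le> K * Linf_norm V f)}"

definition op_norm ::
  "(real \<Rightarrow> real) \<Rightarrow> complex set \<Rightarrow> complex set \<Rightarrow> ((complex \<Rightarrow> complex) \<Rightarrow> complex \<Rightarrow> complex) \<Rightarrow> real" where
  "op_norm r V W T = (SUP f\<in>O_space r. Linf_norm W (T f) / Linf_norm V f)"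

definition op_topology ::
  "(real \<Rightarrow> real) \<Rightarrow> complex set \<Rightarrow> complex set \<Rightarrow> ((complex \<Rightarrow> complex) \<Rightarrow> complex \<Rightarrow> complex) topology" where
  "op_topology r V W = seminorm_topology (bounded_ops r V W) {op_norm r V W}"

definition thickening :: "real \<Rightarrow> complex set \<Rightarrow> complex set" where
  "thickening \<delta> U = {z. infdist z U < \<delta>}"

lemma higher_deriv_poly_0: "(deriv ^^ n) (poly p) (0::complex) = fact n * coeff p n"
proof -
  have eq: "(deriv ^^ n) (poly p) = poly ((pderiv ^^ n) p)"
    by (induction n) (auto intro!: ext DERIV_imp_deriv poly_DERIV)
  show ?thesis
    by (simp add: eq poly_0_coeff_0 coeff_higher_pderiv pochhammer_fact)
qed

text \<open>On polynomials, \<^term>\<open>H_op r \<gamma>\<close> is the finite sum that multiplies each coefficient by the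
  corresponding value of \<open>\<gamma>\<close>.\<close>

lemma H_op_poly:
  assumes "poly p \<in> O_space r"
  shows "H_op r \<gamma> (poly p) z =
    (\<Sum>n | n \<le> degree p \<and> real n > r_zero r. \<gamma> (of_nat n) * coeff p n * z ^ n)"
proof -
  have "H_op r \<gamma> (poly p) z =
      (\<Sum>n. if real n > r_zero r then \<gamma> (of_nat n) * coeff p n * z ^ n else 0)"
    using assms by (simp add: H_op_def higher_deriv_poly_0 cong: if_cong)
  also have "\<dots> = (\<Sum>n\<in>{n. n \<le> degree p \<and> real n > r_zero r}.
      if real n > r_zero r then \<gamma> (of_nat n) * coeff p n * z ^ n else 0)"
    by (rule suminf_finite) (auto simp: coeff_eq_0)
  also have "\<dots> = (\<Sum>n | n \<le> degree p \<and> real n > r_zero r. \<gamma> (of_nat n) * coeff p n * z ^ n)"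
    by (rule sum.cong) auto
  finally show ?thesis .
qed

end

theory Submission
  imports Defs
begin

text \<open>The multiplier \<open>\<gamma>\<close> acts by convolution with \<open>K(w) = \<Sum>\<^sub>n \<gamma>(n) w\<^sup>n\<close>:
  \<open>H\<^sub>\<gamma> f(z) = (2\<pi>i)\<^sup>-\<^sup>1 \<integral> K(z/\<zeta>) f(\<zeta>)/\<zeta> d\<zeta>\<close>, first over a large circle, where the
  power series converges. By a theorem of Lindelof, \<open>K\<close> continues to the plane cut along
  \<open>[1,\<infinity>)\<close>: the residue theorem on triangles with vertex \<open>N - 1/2\<close> that grow to a sector turns
  the tail of the series into an integral of \<open>\<gamma>(s) e\<^sup>s\<^sup>L / sin(\<pi>s)\<close>, \<open>L = log(-w)\<close>, over two rays.
  On a steep ray the decay of \<open>1/sin(\<pi>s)\<close> beats the growth of the other two factors, locally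
  uniformly in \<open>w\<close>. As \<open>U\<close> is star-shaped, \<open>z/\<zeta>\<close> avoids \<open>[1,\<infinity>)\<close> for \<open>z\<close> in \<open>U\<close> and \<open>\<zeta>\<close>
  outside the closure of \<open>U\<close>, so the circle can be moved into the thickening of \<open>U\<close>. All bounds are
  linear in finitely many seminorms of \<open>\<gamma>\<close>, and \<open>H\<^sub>\<gamma>\<close> is linear in \<open>\<gamma>\<close>, which gives continuity.\<close>

text \<open>Functions in \<open>S_space r\<close> are controlled only on sectors of half-angle less
  than pi/2, with a threshold and a constant that depend on the angle, so no single pair of rays
  serves the whole cut plane. If |Im L| stays below pi - \<eta>, a ray of slope \<tau> gains \<eta>
  \<tau> per unit of Re s from 1/sin(\<pi>s) against exp(sL). This gain must pay for Re L and for
  the growth exp(\<epsilon>|s|) of \<gamma>. Hence \<tau> grows as w approaches the cut or infinity,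
  and with it the angle, the threshold N and the list of seminorms. For this reason K is never
  continued to the whole cut plane at once: each \<eta> has its own region
  \<open>cut_disc \<eta>\<close>, and compactness of the set of quotients z/\<zeta> supplies one
  \<eta> for all of them. Seminorms and constants are always chosen before \<gamma>; without this
  order of quantifiers there would be no continuity in \<gamma>. The half-integer vertex keeps the
  contours away from the poles of 1/sin(\<pi>s).\<close>

section \<open>Lindelof continuation of a power series\<close>

text \<open>The square of |sin(\<pi>s)| is (cosh(2 pi Im s) - cos(2 pi Re s))/2. Either alternative
  keeps the cosine from cancelling the growing exponential. With E = exp(2 pi |Im s|) the estimate
  even gives E/8; E/16 is the square of the bound asserted.\<close>

lemma exp_le_norm_sin_pi:
  fixes s :: complex
  assumes "cos (2 * pi * Re s) \<le> 0 \<or> 1 \<le> \<bar>Im s\<bar>"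
  shows "exp (pi * \<bar>Im s\<bar>) / 4 \<le> norm (sin (of_real pi * s))"
proof -
  define E where "E = exp (2 * pi * \<bar>Im s\<bar>)"
  have E: "E > 0" by (simp add: E_def)
  have "norm (sin (of_real pi * s)) ^ 2 = (E + inverse E - 2 * cos (2 * pi * Re s)) / 4"
    by (cases "Im s \<ge> 0") (simp_all add: norm_sin_squared E_def exp_minus mult.assoc)
  moreover have "E / 2 \<le> E - 2 * cos (2 * pi * Re s)"
  proof (cases "cos (2 * pi * Re s) \<le> 0")
    case True
    with E show ?thesis by linarith
  next
    case False
    then have "2 * pi * 1 \<le> 2 * pi * \<bar>Im s\<bar>" using assms by (intro mult_left_mono) auto
    also have "1 + \<dots> \<le> E" unfolding E_def by (rule exp_ge_add_one_self)
    finally have "4 \<le> E" using pi_gt3 by linarith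
    moreover have "cos (2 * pi * Re s) \<le> 1" by simp
    ultimately show ?thesis by linarith
  qed
  moreover have "E / 16 \<le> (E + i - 2 * c) / 4" if "E / 2 \<le> E - 2 * c" "0 < i" for c i
    using that E by (simp add: field_simps)
  ultimately have le: "E / 16 \<le> norm (sin (of_real pi * s)) ^ 2"
    using positive_imp_inverse_positive[OF E] by presburger
  have "(exp (pi * \<bar>Im s\<bar>) / 4) ^ 2 = E / 16"
    by (simp add: E_def power_divide flip: exp_double)
  with le have "(exp (pi * \<bar>Im s\<bar>) / 4) ^ 2 \<le> norm (sin (of_real pi * s)) ^ 2"
    by (simp only:)
  then show ?thesis by (rule power2_le_imp_le) simp
qed

lemma cos_two_pi_half_odd:
  "cos (2 * pi * (real n - 1/2 + t)) = - cos (2 * pi * t)"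
proof -
  have "2 * pi * (real n - 1/2 + t) = (2 * real n * pi) + (2 * pi * t - pi)"
    by (simp add: field_simps)
  then show ?thesis by (simp only: cos_add cos_2npi sin_2npi) simp
qed

text \<open>The parameter is L instead of w = - exp L, so that the complex power exp(sL) of -w needs
  no choice of branch.\<close>

definition kern :: "(complex \<Rightarrow> complex) \<Rightarrow> complex \<Rightarrow> complex \<Rightarrow> complex" where
  "kern g L s = g s * exp (s * L) / sin (of_real pi * s)"

text \<open>In the imaginary direction exp(sL) grows at rate at most pi - \<eta>, while
  1/sin(\<pi>s) decays at rate pi; \<eta> is what is left.\<close>

lemma norm_kern_le:
  assumes g: "norm (g s) \<le> P * exp (\<epsilon> * norm s)"
    and s: "cos (2 * pi * Re s) \<le> 0 \<or> 1 \<le> \<bar>Im s\<bar>"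
    and L: "\<bar>Im L\<bar> \<le> pi - \<eta>"
  shows "norm (kern g L s) \<le> 4 * P * exp (\<epsilon> * norm s + Re s * Re L - \<eta> * \<bar>Im s\<bar>)"
proof -
  have "- (Im s * Im L) \<le> \<bar>Im s\<bar> * \<bar>Im L\<bar>" by (simp flip: abs_mult)
  also have "\<dots> \<le> \<bar>Im s\<bar> * (pi - \<eta>)" using L by (intro mult_left_mono) auto
  finally have e: "norm (exp (s * L)) \<le> exp (Re s * Re L + \<bar>Im s\<bar> * (pi - \<eta>))" by simp
  have P: "0 \<le> P"
    using order_trans[OF norm_ge_zero g] by (simp add: zero_le_mult_iff)
  have "norm (kern g L s) = norm (g s) * norm (exp (s * L)) / norm (sin (of_real pi * s))"
    by (simp add: kern_def norm_mult norm_divide)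
  also have "\<dots> \<le> P * exp (\<epsilon> * norm s) * exp (Re s * Re L + \<bar>Im s\<bar> * (pi - \<eta>))
      / (exp (pi * \<bar>Im s\<bar>) / 4)"
    using P by (intro frac_le mult_mono g e exp_le_norm_sin_pi s mult_nonneg_nonneg) auto
  also have "\<dots> = 4 * P * exp (\<epsilon> * norm s + Re s * Re L - \<eta> * \<bar>Im s\<bar>)"
    by (simp add: exp_add exp_diff algebra_simps)
  finally show ?thesis .
qed

text \<open>The parameter is the horizontal distance from the vertex, not arc length: at integer t
  the real part is again a half-integer, where the vertical sides of the triangles are
  placed.\<close>

definition ray :: "nat \<Rightarrow> real \<Rightarrow> real \<Rightarrow> complex" where
  "ray N \<tau> t = Complex (real N - 1/2 + t) (\<tau> * t)"

text \<open>Its angle opens at 0, like the sectors of \<open>S_space\<close>, and not at the vertex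
  N - 1/2 of the rays. The closed contours therefore lie in its interior.\<close>

definition cone_beyond :: "nat \<Rightarrow> real \<Rightarrow> complex set" where
  "cone_beyond N \<tau> = {s. real N - 1 < Re s \<and> \<bar>Im s\<bar> < \<tau> * Re s}"

lemma ray_in_cone:
  assumes "0 < \<tau>" "0 \<le> t" "1 \<le> N" "\<bar>\<sigma>\<bar> = \<tau>"
  shows "ray N \<sigma> t \<in> cone_beyond N \<tau>"
proof -
  have "\<tau> * t < \<tau> * (real N - 1/2 + t)"
    using assms by (intro mult_strict_left_mono) auto
  with assms show ?thesis by (auto simp: ray_def cone_beyond_def abs_mult)
qed

text \<open>Origin of the slope bound 4: as long as |Im s| < 1, the real part is within 1/4 of the
  half-integer N - 1/2, where the cosine is not positive.\<close>

lemma sin_cond_ray: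
  assumes "4 \<le> \<bar>\<sigma>\<bar>" "0 \<le> t"
  shows "cos (2 * pi * Re (ray N \<sigma> t)) \<le> 0 \<or> 1 \<le> \<bar>Im (ray N \<sigma> t)\<bar>"
proof (cases "1 \<le> \<bar>\<sigma> * t\<bar>")
  case False
  have "4 * t \<le> \<bar>\<sigma>\<bar> * t" using assms by (intro mult_right_mono)
  with False assms(2) have "t \<le> 1/4" by (simp add: abs_mult)
  then have "2 * pi * t \<le> 2 * pi * (1/4)" by (intro mult_left_mono) auto
  moreover have "0 \<le> 2 * pi * t" using assms(2) by simp
  ultimately have "0 \<le> cos (2 * pi * t)"
    using pi_gt_zero by (intro cos_ge_zero) linarith+
  then show ?thesis by (simp add: ray_def cos_two_pi_half_odd)
qed (simp add: ray_def)

lemma linepath_ray: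
  "linepath (ray N \<sigma> x) (ray N \<sigma> y) t = ray N \<sigma> ((1 - t) * x + t * y)"
  by (simp add: linepath_def ray_def complex_eq_iff algebra_simps)

lemma closed_segment_ray:
  assumes "x \<le> y"
  shows "closed_segment (ray N \<sigma> x) (ray N \<sigma> y) = ray N \<sigma> ` {x..y}"
proof -
  have "closed_segment (ray N \<sigma> x) (ray N \<sigma> y) = linepath (ray N \<sigma> x) (ray N \<sigma> y) ` {0..1}"
    by (simp add: linepath_image_01)
  also have "\<dots> = ray N \<sigma> ` ((\<lambda>t. (1 - t) * x + t * y) ` {0..1})"
    by (simp add: linepath_ray image_image)
  also have "(\<lambda>t. (1 - t) * x + t * y) ` {0..1} = {x..y}"
    using assms closed_segment_eq_real_ivl[of x y] closed_segment_image_interval[of x y] by auto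
  finally show ?thesis .
qed

text \<open>In terms of w = - exp L: the modulus stays below exp \<Lambda>, and the argument of w
  stays away from that of the positive axis by more than \<eta>.\<close>

definition strip :: "real \<Rightarrow> real \<Rightarrow> complex set" where
  "strip \<Lambda> \<eta> = {L. Re L < \<Lambda> \<and> \<bar>Im L\<bar> < pi - \<eta>}"

lemma open_strip: "open (strip \<Lambda> \<eta>)"
  unfolding strip_def by (intro open_Collect_conj open_Collect_less continuous_intros)

lemma convex_strip: "convex (strip \<Lambda> \<eta>)"
proof -
  have "strip \<Lambda> \<eta> = {L. Re L < \<Lambda>} \<inter> {L. Im L < pi - \<eta>} \<inter> {L. Im L > - (pi - \<eta>)}"
    by (auto simp: strip_def abs_less_iff)
  then show ?thesis
    by (simp add: convex_Int convex_halfspace_Re_lt convex_halfspace_Im_lt convex_halfspace_Im_gt)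
qed

text \<open>L enters only through exp(sL), so the integrand is a continuous weight times an
  exponential and can be differentiated under the integral.\<close>

lemma holomorphic_contour_integral_kern:
  assumes g: "continuous_on (closed_segment A B) g"
    and nz: "\<And>s. s \<in> closed_segment A B \<Longrightarrow> sin (of_real pi * s) \<noteq> 0"
    and U: "convex U"
  shows "(\<lambda>L. contour_integral (linepath A B) (kern g L)) holomorphic_on U"
proof -
  define c where "c t = g (linepath A B t) / sin (of_real pi * linepath A B t) * (B - A)" for t
  have lp: "linepath A B t \<in> closed_segment A B" if "t \<in> {0..1}" for t
    using that by (metis linepath_image_01 imageI)
  have "continuous_on {0..1} (\<lambda>t. g (linepath A B t))"
    by (rule continuous_on_compose2[OF g]) (use lp in \<open>auto intro: continuous_intros\<close>)
  then have c: "continuous_on {0..1} c"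
    unfolding c_def using nz lp by (intro continuous_intros) auto
  have eq: "contour_integral (linepath A B) (kern g L) =
      integral (cbox 0 1) (\<lambda>t. c t * exp (linepath A B t * L))" for L
    by (simp add: contour_integral_integral kern_def c_def mult_ac cbox_interval)
  show ?thesis
    unfolding eq
  proof (rule leibniz_rule_holomorphic[OF _ _ _ U])
    fix L t assume "L \<in> U" "t \<in> cbox (0::real) 1"
    show "((\<lambda>L. c t * exp (linepath A B t * L)) has_field_derivative
        c t * (linepath A B t * exp (linepath A B t * L))) (at L within U)"
      by (auto intro!: derivative_eq_intros)
  next
    fix L assume "L \<in> U"
    show "(\<lambda>t. c t * exp (linepath A B t * L)) integrable_on cbox 0 1"
      using c by (intro integrable_continuous continuous_intros) auto
  next
    have "continuous_on (U \<times> cbox 0 1) (\<lambda>x. c (snd x))"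
      by (rule continuous_on_compose2[OF c]) (auto intro: continuous_intros)
    then show "continuous_on (U \<times> cbox 0 1)
        (\<lambda>(L, t). c t * (linepath A B t * exp (linepath A B t * L)))"
      unfolding case_prod_unfold linepath_def by (intro continuous_intros)
  qed
qed

text \<open>The last condition comes from |s| \<le> N - 1/2 + (1 + \<tau>) t on the rays: the growth
  allowed for g then costs at most 1 per unit of t.\<close>

locale cone_function =
  fixes g :: "complex \<Rightarrow> complex" and N :: nat and \<tau> \<epsilon> P :: real
  assumes holo: "g holomorphic_on cone_beyond N \<tau>"
    and bound: "\<And>s. s \<in> cone_beyond N \<tau> \<Longrightarrow> norm (g s) \<le> P * exp (\<epsilon> * norm s)"
    and N: "1 \<le> N" and \<tau>: "4 \<le> \<tau>" and \<epsilon>: "0 < \<epsilon>" "\<epsilon> * (1 + \<tau>) \<le> 1"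
begin

lemma P_nonneg: "0 \<le> P"
proof -
  have "ray N \<tau> 0 \<in> cone_beyond N \<tau>" using N \<tau> by (intro ray_in_cone) auto
  from order_trans[OF norm_ge_zero bound[OF this]] show ?thesis by (simp add: zero_le_mult_iff)
qed

text \<open>Balance per unit of t: the growth of g costs at most 1, Re L costs at most \<Lambda>,
  and the decay pays \<tau> \<eta> \<ge> \<Lambda> + 2. The surplus 1 is the factor exp(-t); the
  vertex contributes exp(N(1 + \<Lambda>)).\<close>

lemma norm_kern_ray:
  assumes L: "L \<in> strip \<Lambda> \<eta>" and "0 \<le> \<Lambda>" and \<eta>: "\<Lambda> + 2 \<le> \<tau> * \<eta>"
    and t: "0 \<le> t" and \<sigma>: "\<bar>\<sigma>\<bar> = \<tau>"
  shows "norm (kern g L (ray N \<sigma> t)) \<le> 4 * P * exp (real N * (1 + \<Lambda>)) * exp (- t)"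
proof -
  define s where "s = ray N \<sigma> t"
  define a where "a = real N - 1/2"
  have s: "s \<in> cone_beyond N \<tau>" unfolding s_def using N \<tau> t \<sigma> by (intro ray_in_cone) auto
  have a: "0 \<le> a" using N by (simp add: a_def)
  have Re: "Re s = a + t" and Im: "\<bar>Im s\<bar> = \<tau> * t"
    using t \<sigma> by (auto simp: s_def a_def ray_def abs_mult)
  have "norm (kern g L s) \<le> 4 * P * exp (\<epsilon> * norm s + Re s * Re L - \<eta> * \<bar>Im s\<bar>)"
    using L \<tau> t \<sigma> bound[OF s] sin_cond_ray[of \<sigma> t N]
    by (intro norm_kern_le) (auto simp: strip_def s_def)
  also have "\<epsilon> * norm s + Re s * Re L - \<eta> * \<bar>Im s\<bar> \<le> real N * (1 + \<Lambda>) - t"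
  proof -
    have "\<epsilon> * norm s \<le> \<epsilon> * (a + t * (1 + \<tau>))"
      using cmod_le[of s] a t \<epsilon>(1) by (intro mult_left_mono) (auto simp: Re Im algebra_simps)
    also have "\<dots> = \<epsilon> * a + t * (\<epsilon> * (1 + \<tau>))" by (simp add: algebra_simps)
    also have "\<dots> \<le> 1 * a + t * 1"
    proof (intro add_mono mult_right_mono mult_left_mono)
      have "\<epsilon> * 1 \<le> \<epsilon> * (1 + \<tau>)" using \<epsilon> \<tau> by (intro mult_left_mono) auto
      then show "\<epsilon> \<le> 1" using \<epsilon> by linarith
    qed (use a t \<epsilon> in auto)
    finally have 1: "\<epsilon> * norm s \<le> a + t" by simp
    have 2: "Re s * Re L \<le> (a + t) * \<Lambda>"
      using L a t by (auto simp: Re strip_def intro!: mult_left_mono)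
    have "(\<Lambda> + 2) * t \<le> \<tau> * \<eta> * t" using \<eta> t by (intro mult_right_mono)
    then have 3: "(\<Lambda> + 2) * t \<le> \<eta> * \<bar>Im s\<bar>" by (simp add: Im mult_ac)
    have "a * (1 + \<Lambda>) \<le> real N * (1 + \<Lambda>)"
      using \<open>0 \<le> \<Lambda>\<close> by (intro mult_right_mono) (auto simp: a_def)
    with 1 2 3 show ?thesis by (simp add: algebra_simps)
  qed
  finally show ?thesis using P_nonneg
    by (simp add: s_def mult_left_mono exp_diff exp_minus divide_inverse)
qed

lemma sin_ray_nonzero:
  assumes "0 \<le> t" "\<bar>\<sigma>\<bar> = \<tau>"
  shows "sin (of_real pi * ray N \<sigma> t) \<noteq> 0"
proof -
  have "0 < exp (pi * \<bar>Im (ray N \<sigma> t)\<bar>) / 4" by simp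
  also have "\<dots> \<le> norm (sin (of_real pi * ray N \<sigma> t))"
    using assms \<tau> by (intro exp_le_norm_sin_pi sin_cond_ray) auto
  finally show ?thesis by auto
qed

lemma continuous_on_g: "S \<subseteq> cone_beyond N \<tau> \<Longrightarrow> continuous_on S g"
  using holo holomorphic_on_imp_continuous_on continuous_on_subset by blast

lemma ray_segment_subset_cone:
  assumes "0 \<le> x" "x \<le> y" "\<bar>\<sigma>\<bar> = \<tau>"
  shows "closed_segment (ray N \<sigma> x) (ray N \<sigma> y) \<subseteq> cone_beyond N \<tau>"
  using assms N \<tau> by (auto simp: closed_segment_ray intro!: ray_in_cone)

lemma continuous_on_kern_ray:
  assumes "0 \<le> x" "x \<le> y" "\<bar>\<sigma>\<bar> = \<tau>"
  shows "continuous_on (closed_segment (ray N \<sigma> x) (ray N \<sigma> y)) (kern g L)"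
proof -
  have "continuous_on (closed_segment (ray N \<sigma> x) (ray N \<sigma> y)) g"
    using assms by (intro continuous_on_g ray_segment_subset_cone)
  then show ?thesis
    unfolding kern_def using assms
    by (intro continuous_intros) (auto simp: closed_segment_ray sin_ray_nonzero)
qed

text \<open>The improper integral along a ray is encoded as a series of integrals over unit
  parameter intervals, so that convergence, bound and holomorphy in L all follow from the
  Weierstrass test.\<close>

definition piece :: "real \<Rightarrow> complex \<Rightarrow> nat \<Rightarrow> complex" where
  "piece \<sigma> L k = contour_integral (linepath (ray N \<sigma> k) (ray N \<sigma> (Suc k))) (kern g L)"

lemma sum_piece:
  assumes "\<bar>\<sigma>\<bar> = \<tau>"
  shows "(\<Sum>k<m. piece \<sigma> L k) = contour_integral (linepath (ray N \<sigma> 0) (ray N \<sigma> m)) (kern g L)"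
proof (induction m)
  case (Suc m)
  have "contour_integral (linepath (ray N \<sigma> 0) (ray N \<sigma> (Suc m))) (kern g L) =
      contour_integral (linepath (ray N \<sigma> 0) (ray N \<sigma> m)) (kern g L) + piece \<sigma> L m"
    unfolding piece_def using assms
    by (intro contour_integral_split_linepath continuous_on_kern_ray)
       (auto simp: closed_segment_ray)
  with Suc show ?case by simp
qed (simp add: contour_integral_integral)

lemma norm_piece_le:
  assumes L: "L \<in> strip \<Lambda> \<eta>" and "0 \<le> \<Lambda>" and \<eta>: "\<Lambda> + 2 \<le> \<tau> * \<eta>" and \<sigma>: "\<bar>\<sigma>\<bar> = \<tau>"
  shows "norm (piece \<sigma> L k) \<le> 4 * P * exp (real N * (1 + \<Lambda>)) * (1 + \<tau>) * exp (- 1) ^ k"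
proof -
  let ?A = "ray N \<sigma> k" and ?B = "ray N \<sigma> (Suc k)"
  let ?C = "4 * P * exp (real N * (1 + \<Lambda>))"
  have "norm (piece \<sigma> L k) \<le> ?C * exp (- real k) * norm (?B - ?A)"
    unfolding piece_def
  proof (rule contour_integral_bound_linepath)
    show "kern g L contour_integrable_on linepath ?A ?B"
      using \<sigma> by (intro contour_integrable_continuous_linepath continuous_on_kern_ray) auto
    show "0 \<le> ?C * exp (- real k)" using P_nonneg by simp
    fix s assume "s \<in> closed_segment ?A ?B"
    then obtain t where t: "s = ray N \<sigma> t" "real k \<le> t"
      by (auto simp: closed_segment_ray)
    then have "norm (kern g L s) \<le> ?C * exp (- t)"
      using assms norm_kern_ray[of L \<Lambda> \<eta> t \<sigma>] by auto
    also have "\<dots> \<le> ?C * exp (- real k)"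
      using P_nonneg t by (intro mult_left_mono) auto
    finally show "norm (kern g L s) \<le> ?C * exp (- real k)" .
  qed
  also have "\<dots> \<le> ?C * exp (- real k) * (1 + \<tau>)"
  proof (rule mult_left_mono)
    have "?B - ?A = Complex 1 \<sigma>" by (simp add: ray_def complex_eq_iff algebra_simps)
    then show "norm (?B - ?A) \<le> 1 + \<tau>" using cmod_le[of "?B - ?A"] \<sigma> by simp
    show "0 \<le> ?C * exp (- real k)" using P_nonneg by simp
  qed
  also have "exp (- real k) = exp (- 1) ^ k" by (simp flip: exp_of_nat_mult)
  finally show ?thesis by (simp add: mult_ac)
qed

lemma ray_integral:
  assumes "0 \<le> \<Lambda>" and \<eta>: "\<Lambda> + 2 \<le> \<tau> * \<eta>" and \<sigma>: "\<bar>\<sigma>\<bar> = \<tau>"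
  obtains J where "J holomorphic_on strip \<Lambda> \<eta>"
    "\<And>L. L \<in> strip \<Lambda> \<eta> \<Longrightarrow> piece \<sigma> L sums J L"
    "\<And>L. L \<in> strip \<Lambda> \<eta> \<Longrightarrow> norm (J L) \<le> 8 * exp (real N * (1 + \<Lambda>)) * (1 + \<tau>) * P"
proof
  let ?S = "strip \<Lambda> \<eta>"
  define C where "C = 4 * P * exp (real N * (1 + \<Lambda>)) * (1 + \<tau>)"
  define J where "J L = (\<Sum>k. piece \<sigma> L k)" for L
  have le: "norm (piece \<sigma> L k) \<le> C * exp (- 1) ^ k" if "L \<in> ?S" for L k
    unfolding C_def using that assms by (intro norm_piece_le)
  have sm: "summable (\<lambda>k. C * exp (- 1 :: real) ^ k)"
    by (intro summable_mult summable_geometric) simp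
  have ul: "uniform_limit ?S (\<lambda>m L. \<Sum>k<m. piece \<sigma> L k) J sequentially"
    unfolding J_def using le sm by (intro Weierstrass_m_test)
  have hol: "(\<lambda>L. piece \<sigma> L k) holomorphic_on ?S" for k
    unfolding piece_def
    using \<sigma> by (intro holomorphic_contour_integral_kern continuous_on_g ray_segment_subset_cone convex_strip)
        (auto simp: closed_segment_ray sin_ray_nonzero)
  show "J holomorphic_on ?S"
  proof (rule holomorphic_uniform_sequence[OF open_strip])
    show "(\<lambda>L. \<Sum>k<m. piece \<sigma> L k) holomorphic_on ?S" for m
      using hol by (intro holomorphic_intros)
    fix L assume "L \<in> ?S"
    then obtain d where "0 < d" "cball L d \<subseteq> ?S"
      using open_strip open_contains_cball by blast
    then show "\<exists>d>0. cball L d \<subseteq> ?S \<and>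
        uniform_limit (cball L d) (\<lambda>m L. \<Sum>k<m. piece \<sigma> L k) J sequentially"
      using ul uniform_limit_on_subset by blast
  qed
  fix L assume L: "L \<in> ?S"
  have smp: "summable (\<lambda>k. norm (piece \<sigma> L k))"
    using le[OF L] by (intro summable_comparison_test'[OF sm]) auto
  then show "piece \<sigma> L sums J L"
    unfolding J_def using summable_norm_cancel summable_sums by blast
  have "norm (J L) \<le> (\<Sum>k. C * exp (- 1) ^ k)"
    unfolding J_def using le[OF L] smp sm
    by (intro order_trans[OF summable_norm[OF smp] suminf_le]) auto
  also have "\<dots> = C * (1 / (1 - exp (- 1)))"
    by (subst suminf_mult) (auto intro: summable_geometric simp: suminf_geometric)
  \<comment> \<open>As e \<ge> 2, the geometric series of ratio 1/e sums to at most 2; this turns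
    the constant 4 of the pieces into 8.\<close>
  also have "\<dots> \<le> C * 2"
  proof (rule mult_left_mono)
    have "2 \<le> exp (1::real)" using exp_ge_add_one_self[of 1] by simp
    then show "1 / (1 - exp (- 1 :: real)) \<le> 2" by (simp add: exp_minus field_simps)
    show "0 \<le> C" using P_nonneg \<tau> by (simp add: C_def)
  qed
  finally show "norm (J L) \<le> 8 * exp (real N * (1 + \<Lambda>)) * (1 + \<tau>) * P"
    by (simp add: C_def mult_ac)
qed

end

section \<open>Residues at the integers and the growing triangles\<close>

lemma sin_pi_times_eq_0:
  fixes s :: complex
  shows "sin (of_real pi * s) = 0 \<longleftrightarrow> s \<in> \<int>"
proof -
  have "sin (of_real pi * s) = 0 \<longleftrightarrow> (\<exists>n::int. of_real pi * s = of_real (of_int n * pi))"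
    by (simp add: sin_eq_0)
  also have "\<dots> \<longleftrightarrow> (\<exists>n::int. s = of_int n)" by (auto simp: mult.commute)
  finally show ?thesis by (auto simp: Ints_def)
qed

text \<open>Near n, sin(\<pi>s) behaves like (-1)^n \<pi> (s - n). The sign combines with exp(nL) to
  (- exp L)^n, so the residues are the terms of the power series in w = - exp L, up to the factor
  1/\<pi>.\<close>

lemma residue_kern:
  assumes "open S" "of_nat n \<in> S" "g holomorphic_on S"
  shows "residue (kern g L) (of_nat n) = g (of_nat n) * (- exp L) ^ n / of_real pi"
proof -
  \<comment> \<open>A ball of radius 1 about n contains no other integer, hence no other
    pole.\<close>
  define A where "A = S \<inter> ball (of_nat n) 1"
  have int: "s = of_nat n" if "s \<in> A" "s \<in> \<int>" for s
  proof -
    obtain k where k: "s = of_int k" using \<open>s \<in> \<int>\<close> by (auto simp: Ints_def)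
    have "norm (of_int (k - int n) :: complex) < 1"
      using that(1) by (simp add: A_def k dist_norm norm_minus_commute)
    then have "\<bar>k - int n\<bar> < 1" unfolding norm_of_int by linarith
    then show ?thesis by (simp add: k)
  qed
  show ?thesis
  proof (rule residue_simple')
    show "open A" "of_nat n \<in> A" using assms by (auto simp: A_def)
    show "kern g L holomorphic_on A - {of_nat n}"
      unfolding kern_def using int
      by (intro holomorphic_intros holomorphic_on_subset[OF assms(3)])
         (auto simp: A_def sin_pi_times_eq_0)
    let ?d = "of_real pi * cos (of_real pi * of_nat n) :: complex"
    have cos: "cos (of_real pi * of_nat n :: complex) = (- 1) ^ n"
      by (induction n) (auto simp: algebra_simps cos_add)
    have sin0: "sin (of_real pi * of_nat n :: complex) = 0" by (simp add: sin_pi_times_eq_0)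
    have "((\<lambda>s. sin (of_real pi * s)) has_field_derivative ?d) (at (of_nat n))"
      by (auto intro!: derivative_eq_intros)
    then have "((\<lambda>s. sin (of_real pi * s) / (s - of_nat n)) \<longlongrightarrow> ?d) (at (of_nat n))"
      by (simp add: has_field_derivative_iff sin0)
    moreover have "((\<lambda>s. g s * exp (s * L)) \<longlongrightarrow> g (of_nat n) * exp (of_nat n * L)) (at (of_nat n))"
    proof -
      have "continuous_on S (\<lambda>s. g s * exp (s * L))"
        by (intro continuous_intros holomorphic_on_imp_continuous_on assms)
      then show ?thesis using assms by (simp add: continuous_on_eq_continuous_at isCont_def)
    qed
    ultimately have "((\<lambda>s. g s * exp (s * L) / (sin (of_real pi * s) / (s - of_nat n)))
        \<longlongrightarrow> g (of_nat n) * exp (of_nat n * L) / ?d) (at (of_nat n))"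
      by (intro tendsto_divide) (auto simp: cos)
    then show "((\<lambda>s. kern g L s * (s - of_nat n)) \<longlongrightarrow>
        g (of_nat n) * (- exp L) ^ n / of_real pi) (at (of_nat n))"
      by (cases "even n") (simp_all add: kern_def cos exp_of_nat_mult)
  qed
qed

text \<open>The lower corner precedes the upper one, so the boundary runs counterclockwise. It
  remains to see that the real points between vertex and side are interior.\<close>

lemma winding_number_ray_triangle:
  assumes "0 < \<tau>" "0 < m" and s: "Im s = 0" "real N - 1/2 < Re s" "Re s < real N - 1/2 + m"
  shows "winding_number (linepath (ray N \<tau> 0) (ray N (-\<tau>) m) +++
      linepath (ray N (-\<tau>) m) (ray N \<tau> m) +++ linepath (ray N \<tau> m) (ray N \<tau> 0)) s = 1"
proof -
  let ?a = "real N - 1/2"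
  let ?T = "{w. ?a < Re w \<and> Re w < ?a + m \<and> \<bar>Im w\<bar> < \<tau> * (Re w - ?a)}"
  have "?T \<subseteq> convex hull {ray N \<tau> 0, ray N (-\<tau>) m, ray N \<tau> m}"
  proof
    fix w assume w: "w \<in> ?T"
    \<comment> \<open>Relative distance from the vertex, and y is the height in units of half the
      vertical side; the barycentric coordinates of w are then 1 - t, (t - y)/2 and (t +
      y)/2.\<close>
    define t where "t = (Re w - ?a) / m"
    define y where "y = Im w / (\<tau> * m)"
    have t: "0 < t" "t < 1" using w assms by (auto simp: t_def field_simps)
    have y: "\<bar>y\<bar> < t" using w assms by (auto simp: y_def t_def abs_divide abs_mult field_simps)
    have "w = (1 - t) *\<^sub>R ray N \<tau> 0 + ((t - y) / 2) *\<^sub>R ray N (-\<tau>) m + ((t + y) / 2) *\<^sub>R ray N \<tau> m"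
    proof (rule complex_eqI)
      show "Re w = Re ((1 - t) *\<^sub>R ray N \<tau> 0 + ((t - y) / 2) *\<^sub>R ray N (-\<tau>) m + ((t + y) / 2) *\<^sub>R ray N \<tau> m)"
      proof -
        have "Re w = ?a + t * m" using assms by (simp add: t_def)
        then show ?thesis by (simp add: ray_def algebra_simps) (simp add: field_simps)
      qed
      show "Im w = Im ((1 - t) *\<^sub>R ray N \<tau> 0 + ((t - y) / 2) *\<^sub>R ray N (-\<tau>) m + ((t + y) / 2) *\<^sub>R ray N \<tau> m)"
      proof -
        have "Im w = y * (\<tau> * m)" using assms by (simp add: y_def)
        then show ?thesis by (simp add: ray_def algebra_simps) (simp add: field_simps)
      qed
    qed
    moreover have "0 \<le> 1 - t" "0 \<le> (t - y) / 2" "0 \<le> (t + y) / 2" using t y by auto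
    moreover have "(1 - t) + (t - y) / 2 + (t + y) / 2 = 1" by (simp add: field_simps)
    ultimately show "w \<in> convex hull {ray N \<tau> 0, ray N (-\<tau>) m, ray N \<tau> m}"
      unfolding convex_hull_3 by blast
  qed
  moreover have "open ?T"
    by (intro open_Collect_conj open_Collect_less continuous_intros)
  ultimately have "s \<in> interior (convex hull {ray N \<tau> 0, ray N (-\<tau>) m, ray N \<tau> m})"
    using assms by (intro interior_maximal[THEN subsetD]) auto
  moreover have "0 < Im ((ray N (-\<tau>) m - ray N \<tau> 0) * cnj (ray N (-\<tau>) m - s))"
  proof -
    have "Im ((ray N (-\<tau>) m - ray N \<tau> 0) * cnj (ray N (-\<tau>) m - s)) = m * \<tau> * (Re s - ?a)"
      using s(1) by (simp add: ray_def algebra_simps)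
    then show ?thesis using assms by simp
  qed
  ultimately show ?thesis by (simp add: winding_number_triangle)
qed

context cone_function
begin

lemma side_segment:
  assumes s: "s \<in> closed_segment (ray N (-\<tau>) m) (ray N \<tau> m)" and m: "0 \<le> m"
  shows "Re s = real N - 1/2 + m" "\<bar>Im s\<bar> \<le> \<tau> * m"
proof -
  obtain u where u: "0 \<le> u" "u \<le> 1" "s = (1 - u) *\<^sub>R ray N (-\<tau>) m + u *\<^sub>R ray N \<tau> m"
    using s by (auto simp: in_segment)
  show "Re s = real N - 1/2 + m" by (simp add: u(3) ray_def algebra_simps)
  have "Im s = (2 * u - 1) * (\<tau> * m)" by (simp add: u(3) ray_def algebra_simps)
  then have "\<bar>Im s\<bar> = \<bar>2 * u - 1\<bar> * (\<tau> * m)" using m \<tau> by (simp add: abs_mult)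
  also have "\<dots> \<le> 1 * (\<tau> * m)" using u m \<tau> by (intro mult_right_mono) auto
  finally show "\<bar>Im s\<bar> \<le> \<tau> * m" by simp
qed

lemma side_in_cone:
  assumes s: "s \<in> closed_segment (ray N (-\<tau>) m) (ray N \<tau> m)" and m: "0 \<le> m"
  shows "s \<in> cone_beyond N \<tau>"
proof -
  have "\<tau> * m < \<tau> * (real N - 1/2 + m)" using \<tau> N by (intro mult_strict_left_mono) auto
  with side_segment[OF assms] m show ?thesis by (auto simp: cone_beyond_def)
qed

text \<open>For integer m the side lies over the half-integer N + m - 1/2, where cos(2 pi Re s) =
  -1.\<close>

lemma sin_side_nonzero:
  assumes s: "s \<in> closed_segment (ray N (-\<tau>) (real m)) (ray N \<tau> (real m))"
  shows "cos (2 * pi * Re s) \<le> 0" "sin (of_real pi * s) \<noteq> 0"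
proof -
  have "Re s = real (N + m) - 1/2 + 0" using side_segment[OF s] by simp
  then show *: "cos (2 * pi * Re s) \<le> 0" by (simp only: cos_two_pi_half_odd) simp
  have "0 < exp (pi * \<bar>Im s\<bar>) / 4" by simp
  also have "\<dots> \<le> norm (sin (of_real pi * s))" using * by (intro exp_le_norm_sin_pi) auto
  finally show "sin (of_real pi * s) \<noteq> 0" by auto
qed

lemma continuous_on_kern_side:
  "continuous_on (closed_segment (ray N (-\<tau>) (real m)) (ray N \<tau> (real m))) (kern g L)"
proof -
  have "continuous_on (closed_segment (ray N (-\<tau>) (real m)) (ray N \<tau> (real m))) g"
    using side_in_cone by (intro continuous_on_g) auto
  then show ?thesis
    unfolding kern_def by (intro continuous_intros) (auto simp: sin_side_nonzero)
qed

text \<open>The factor 2 i is 2 pi i from the residue theorem times 1/pi from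
  \<open>residue_kern\<close>. The triangle leaves along the lower ray and returns along the upper
  one, whence the opposite signs.\<close>

lemma triangle_integral:
  "(\<Sum>k<m. piece (-\<tau>) L k) - (\<Sum>k<m. piece \<tau> L k) +
     contour_integral (linepath (ray N (-\<tau>) m) (ray N \<tau> m)) (kern g L) =
   2 * \<i> * (\<Sum>k<m. g (of_nat (N + k)) * (- exp L) ^ (N + k))"
proof (cases "m = 0")
  case False
  let ?a = "ray N \<tau> 0" and ?b = "ray N (-\<tau>) m" and ?c = "ray N \<tau> m"
  let ?T = "linepath ?a ?b +++ linepath ?b ?c +++ linepath ?c ?a"
  \<comment> \<open>The bound N + m - 1/4 lies between the vertical side and the next integer, so
    the only integers in \<open>?S\<close> are N, ..., N + m - 1.\<close>
  let ?S = "cone_beyond N \<tau> \<inter> {s. Re s < real N - 1/4 + m}"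
  let ?p = "of_nat ` {N..<N + m} :: complex set"
  have cone: "open (cone_beyond N \<tau>)" "convex (cone_beyond N \<tau>)"
  proof -
    have "cone_beyond N \<tau> = {s. Re s > real N - 1} \<inter> {s. \<tau> * Re s - Im s > 0} \<inter> {s. \<tau> * Re s + Im s > 0}"
      by (auto simp: cone_beyond_def abs_less_iff)
    moreover have "convex {s. \<tau> * Re s - Im s > 0}"
      using convex_halfspace_gt[of 0 "Complex \<tau> (-1)"] by (simp add: inner_complex_def)
    moreover have "convex {s. \<tau> * Re s + Im s > 0}"
      using convex_halfspace_gt[of 0 "Complex \<tau> 1"] by (simp add: inner_complex_def)
    ultimately show "convex (cone_beyond N \<tau>)" by (simp add: convex_Int convex_halfspace_Re_gt)
    show "open (cone_beyond N \<tau>)"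
      unfolding cone_beyond_def by (intro open_Collect_conj open_Collect_less continuous_intros)
  qed
  have ab: "ray N \<tau> 0 = ray N (-\<tau>) 0" by (simp add: ray_def)
  have S: "open ?S" "convex ?S"
    using cone by (auto intro!: open_Int convex_Int convex_halfspace_Re_lt open_halfspace_Re_lt)
  have im: "path_image ?T \<subseteq> ?S - ?p"
  proof -
    have *: "ray N \<sigma> t \<in> ?S - ?p" if "0 \<le> t" "t \<le> real m" "\<bar>\<sigma>\<bar> = \<tau>" for \<sigma> t
    proof -
      have "ray N \<sigma> t \<notin> \<int>" using sin_ray_nonzero[of t \<sigma>] that by (simp add: sin_pi_times_eq_0)
      then have "ray N \<sigma> t \<notin> ?p" by auto
      moreover have "ray N \<sigma> t \<in> cone_beyond N \<tau>" using that N \<tau> by (intro ray_in_cone) auto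
      ultimately show ?thesis using that by (simp add: ray_def)
    qed
    have 1: "closed_segment ?a ?b \<subseteq> ?S - ?p"
      unfolding ab closed_segment_ray[OF of_nat_0_le_iff]
      by (rule image_subsetI, rule *) (use \<tau> in auto)
    have 2: "closed_segment ?c ?a \<subseteq> ?S - ?p"
      unfolding closed_segment_commute[of ?c] closed_segment_ray[OF of_nat_0_le_iff]
      by (rule image_subsetI, rule *) (use \<tau> in auto)
    have 3: "closed_segment ?b ?c \<subseteq> ?S - ?p"
    proof
      fix s assume s: "s \<in> closed_segment ?b ?c"
      have "s \<notin> \<int>" using sin_side_nonzero(2)[OF s] by (simp add: sin_pi_times_eq_0)
      then have "s \<notin> ?p" by auto
      then show "s \<in> ?S - ?p"
        using side_in_cone[OF s] side_segment(1)[OF s] by simp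
    qed
    show ?thesis using 1 2 3 by (simp add: path_image_join)
  qed
  have ints: "s \<in> ?p" if "s \<in> ?S" "s \<in> \<int>" for s
  proof -
    obtain k where k: "s = of_int k" using \<open>s \<in> \<int>\<close> by (auto simp: Ints_def)
    have "real N - 1 < of_int k" "of_int k < real N - 1/4 + m"
      using \<open>s \<in> ?S\<close> by (auto simp: k cone_beyond_def)
    then have "int N \<le> k" "k < int (N + m)" by linarith+
    then show ?thesis
      unfolding k by (intro image_eqI[of _ _ "nat k"]) auto
  qed
  have mem: "of_nat n \<in> ?S" if "n \<in> {N..<N + m}" for n
    using that N \<tau> by (auto simp: cone_beyond_def)
  have gS: "g holomorphic_on ?S" using holo by (rule holomorphic_on_subset) auto
  have "contour_integral ?T (kern g L) =
      2 * pi * \<i> * (\<Sum>p\<in>?p. winding_number ?T p * residue (kern g L) p)"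
  proof (rule Residue_theorem[OF S(1) convex_connected[OF S(2)] _ _ _ _ im])
    show "kern g L holomorphic_on ?S - ?p"
      unfolding kern_def using ints
      by (intro holomorphic_intros holomorphic_on_subset[OF gS]) (auto simp: sin_pi_times_eq_0)
    show "\<forall>z. z \<notin> ?S \<longrightarrow> winding_number ?T z = 0"
      using S(2) im by (auto intro!: winding_number_zero_outside[where s = ?S])
  qed auto
  also have "(\<Sum>p\<in>?p. winding_number ?T p * residue (kern g L) p) =
      (\<Sum>n=N..<N + m. g (of_nat n) * (- exp L) ^ n / of_real pi)"
  proof (subst sum.reindex)
    show "inj_on (of_nat :: nat \<Rightarrow> complex) {N..<N + m}" by (simp add: inj_on_def)
    show "sum ((\<lambda>p. winding_number ?T p * residue (kern g L) p) \<circ> of_nat) {N..<N + m} =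
      (\<Sum>n=N..<N + m. g (of_nat n) * (- exp L) ^ n / of_real pi)"
    proof (rule sum.cong)
      fix n assume n: "n \<in> {N..<N + m}"
      then have "winding_number ?T (of_nat n) = 1"
        using \<tau> by (intro winding_number_ray_triangle) auto
      moreover have "residue (kern g L) (of_nat n) = g (of_nat n) * (- exp L) ^ n / of_real pi"
        by (rule residue_kern[OF S(1) mem[OF n] gS])
      ultimately show "((\<lambda>p. winding_number ?T p * residue (kern g L) p) \<circ> of_nat) n =
          g (of_nat n) * (- exp L) ^ n / of_real pi" by simp
    qed simp
  qed
  also have "\<dots> = (\<Sum>k<m. g (of_nat (N + k)) * (- exp L) ^ (N + k)) / of_real pi"
    unfolding sum_divide_distrib
    by (rule sum.reindex_bij_witness[of _ "\<lambda>k. N + k" "\<lambda>n. n - N"]) auto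
  finally have T: "contour_integral ?T (kern g L) =
      2 * \<i> * (\<Sum>k<m. g (of_nat (N + k)) * (- exp L) ^ (N + k))" by simp
  have cont: "continuous_on (closed_segment ?a ?b) (kern g L)"
      "continuous_on (closed_segment ?a ?c) (kern g L)"
      "continuous_on (closed_segment ?c ?a) (kern g L)"
    using continuous_on_kern_ray[of 0 m "-\<tau>"] continuous_on_kern_ray[of 0 m \<tau>] \<tau>
    by (simp_all add: ab closed_segment_commute[of ?c])
  then have "contour_integral ?T (kern g L) = contour_integral (linepath ?a ?b) (kern g L) +
      (contour_integral (linepath ?b ?c) (kern g L) + contour_integral (linepath ?c ?a) (kern g L))"
    using continuous_on_kern_side
    by (simp add: contour_integral_join contour_integrable_joinI
        contour_integrable_continuous_linepath del: linepath_refl)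
  also have "contour_integral (linepath ?c ?a) (kern g L) = - contour_integral (linepath ?a ?c) (kern g L)"
    by (rule contour_integral_reverse_linepath[OF cont(3)])
  finally show ?thesis
    using \<tau> T by (simp add: sum_piece ab diff_add_eq add_diff_eq)
qed (simp add: contour_integral_integral ray_def)

end

section \<open>From triangles to the whole sector\<close>

context cone_function
begin

text \<open>Here the decay comes from |w| < \<rho>, which gives the exponent Re s ln \<rho>. The
  growth of g uses up at most half of it, the other half remains, and the factor m is the length of
  the side.\<close>

lemma norm_side_integral_le:
  assumes L: "L \<in> strip \<Lambda> \<eta>" and \<eta>: "0 \<le> \<eta>" and \<rho>: "0 < \<rho>" "\<rho> < 1" "exp (Re L) < \<rho>"
    and \<epsilon>': "\<epsilon> * (1 + \<tau>) \<le> - ln \<rho> / 2"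
  shows "norm (contour_integral (linepath (ray N (-\<tau>) (real m)) (ray N \<tau> (real m))) (kern g L))
    \<le> 8 * P * \<tau> * (real m * exp (ln \<rho> / 2) ^ m)"
proof -
  let ?b = "ray N (-\<tau>) (real m)" and ?c = "ray N \<tau> (real m)"
  have "norm (contour_integral (linepath ?b ?c) (kern g L))
      \<le> 4 * P * exp (ln \<rho> / 2) ^ m * norm (?c - ?b)"
  proof (rule contour_integral_bound_linepath)
    show "kern g L contour_integrable_on linepath ?b ?c"
      by (intro contour_integrable_continuous_linepath continuous_on_kern_side)
    show "0 \<le> 4 * P * exp (ln \<rho> / 2) ^ m" using P_nonneg by simp
    fix s assume s: "s \<in> closed_segment ?b ?c"
    note seg = side_segment[OF s]
    have ln: "ln \<rho> < 0" using \<rho> by simp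
    have "norm (kern g L s) \<le> 4 * P * exp (\<epsilon> * norm s + Re s * Re L - \<eta> * \<bar>Im s\<bar>)"
      using L sin_side_nonzero(1)[OF s] bound[OF side_in_cone[OF s]]
      by (intro norm_kern_le) (auto simp: strip_def)
    also have "\<epsilon> * norm s + Re s * Re L - \<eta> * \<bar>Im s\<bar> \<le> ln \<rho> / 2 * m"
    proof -
      have "\<epsilon> * norm s \<le> \<epsilon> * (Re s * (1 + \<tau>))"
      proof (rule mult_left_mono)
        have "norm s \<le> \<bar>Re s\<bar> + \<bar>Im s\<bar>" by (rule cmod_le)
        also have "\<dots> \<le> Re s + \<tau> * m" using seg N by simp
        also have "\<tau> * m \<le> \<tau> * Re s" using seg N \<tau> by (intro mult_left_mono) auto
        finally show "norm s \<le> Re s * (1 + \<tau>)" by (simp add: algebra_simps)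
      qed (use \<epsilon> in auto)
      also have "\<dots> = Re s * (\<epsilon> * (1 + \<tau>))" by simp
      also have "\<dots> \<le> Re s * (- ln \<rho> / 2)"
        using seg N \<epsilon>' by (intro mult_left_mono) auto
      finally have 1: "\<epsilon> * norm s \<le> Re s * (- ln \<rho> / 2)" .
      have "Re L \<le> ln \<rho>" using \<rho> by (simp add: ln_ge_iff)
      then have 2: "Re s * Re L \<le> Re s * ln \<rho>" using seg N by (intro mult_left_mono) auto
      have 3: "0 \<le> \<eta> * \<bar>Im s\<bar>" using \<eta> by simp
      have "ln \<rho> / 2 * Re s \<le> ln \<rho> / 2 * m"
        using seg N ln by (intro mult_left_mono_neg) auto
      with 1 2 3 show ?thesis by (simp add: algebra_simps)
    qed
    finally show "norm (kern g L s) \<le> 4 * P * exp (ln \<rho> / 2) ^ m"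
      using P_nonneg by (simp add: mult_left_mono mult.commute flip: exp_of_nat_mult)
  qed
  also have "?c - ?b = \<i> * of_real (2 * \<tau> * m)"
    by (simp add: ray_def complex_eq_iff)
  then have "norm (?c - ?b) = 2 * \<tau> * m" using \<tau> by (simp add: norm_mult)
  finally show ?thesis by (simp add: mult_ac)
qed

text \<open>As m grows in \<open>triangle_integral\<close>, the side vanishes for |w| < \<rho>,
  while the two ray integrals converge on the whole strip. Dividing by 2 i averages their two
  bounds, so the constant is that of one ray.\<close>

lemma power_series_continuation:
  assumes \<Lambda>: "0 \<le> \<Lambda>" "\<Lambda> + 2 \<le> \<tau> * \<eta>" and \<rho>: "0 < \<rho>" "\<rho> < 1"
    and \<epsilon>': "\<epsilon> * (1 + \<tau>) \<le> - ln \<rho> / 2"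
  obtains J where "J holomorphic_on strip \<Lambda> \<eta>"
    "\<And>L. L \<in> strip \<Lambda> \<eta> \<Longrightarrow> norm (J L) \<le> 8 * exp (real N * (1 + \<Lambda>)) * (1 + \<tau>) * P"
    "\<And>L. \<lbrakk>L \<in> strip \<Lambda> \<eta>; exp (Re L) < \<rho>\<rbrakk> \<Longrightarrow>
      (\<lambda>k. g (of_nat (N + k)) * (- exp L) ^ (N + k)) sums J L"
proof -
  let ?S = "strip \<Lambda> \<eta>" and ?C = "8 * exp (real N * (1 + \<Lambda>)) * (1 + \<tau>) * P"
  have "\<bar>\<tau>\<bar> = \<tau>" "\<bar>-\<tau>\<bar> = \<tau>" using \<tau> by auto
  obtain J1 where J1: "J1 holomorphic_on ?S"
      "\<And>L. L \<in> ?S \<Longrightarrow> piece (-\<tau>) L sums J1 L" "\<And>L. L \<in> ?S \<Longrightarrow> norm (J1 L) \<le> ?C"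
    using ray_integral[OF \<Lambda> \<open>\<bar>-\<tau>\<bar> = \<tau>\<close>] by metis
  obtain J2 where J2: "J2 holomorphic_on ?S"
      "\<And>L. L \<in> ?S \<Longrightarrow> piece \<tau> L sums J2 L" "\<And>L. L \<in> ?S \<Longrightarrow> norm (J2 L) \<le> ?C"
    using ray_integral[OF \<Lambda> \<open>\<bar>\<tau>\<bar> = \<tau>\<close>] by metis
  have \<eta>: "0 \<le> \<eta>"
  proof -
    have "0 < \<tau> * \<eta>" using \<Lambda> by linarith
    then show ?thesis using \<tau> by (simp add: zero_less_mult_iff)
  qed
  show ?thesis
  proof
    show "(\<lambda>L. (J1 L - J2 L) / (2 * \<i>)) holomorphic_on ?S"
      using J1 J2 by (intro holomorphic_intros) auto
    show "norm ((J1 L - J2 L) / (2 * \<i>)) \<le> ?C" if "L \<in> ?S" for L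
      using norm_triangle_ineq4[of "J1 L" "J2 L"] J1(3)[OF that] J2(3)[OF that]
      by (simp add: norm_divide norm_mult)
    fix L assume L: "L \<in> ?S" "exp (Re L) < \<rho>"
    let ?side = "\<lambda>m. contour_integral (linepath (ray N (-\<tau>) (real m)) (ray N \<tau> (real m))) (kern g L)"
    have "(\<lambda>m. real m * exp (ln \<rho> / 2) ^ m) \<longlonglongrightarrow> 0"
      using \<rho> powser_times_n_limit_0[of "exp (ln \<rho> / 2)"] by simp
    then have lim: "(\<lambda>m. 8 * P * \<tau> * (real m * exp (ln \<rho> / 2) ^ m)) \<longlonglongrightarrow> 0"
      by (rule tendsto_mult_right_zero)
    have side: "?side \<longlonglongrightarrow> 0"
      by (rule Lim_null_comparison[OF always_eventually lim])
         (intro allI norm_side_integral_le[OF L(1) \<eta> \<rho> L(2) \<epsilon>'])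
    have "(\<lambda>m. ((\<Sum>k<m. piece (-\<tau>) L k) - (\<Sum>k<m. piece \<tau> L k) + ?side m) / (2 * \<i>))
        \<longlonglongrightarrow> (J1 L - J2 L + 0) / (2 * \<i>)"
      using J1(2)[OF L(1)] J2(2)[OF L(1)] unfolding sums_def
      by (intro tendsto_divide tendsto_add tendsto_diff side tendsto_const) auto
    then show "(\<lambda>k. g (of_nat (N + k)) * (- exp L) ^ (N + k)) sums ((J1 L - J2 L) / (2 * \<i>))"
      unfolding triangle_integral sums_def by simp
  qed
qed

end

text \<open>An exhaustion of the plane cut along [1,\<infinity>) by one parameter tending to 0. The
  logarithmic part misses all of [0,\<infinity>), and the disc restores [0, 1 - \<eta>).\<close>

definition cut_disc :: "real \<Rightarrow> complex set" where
  "cut_disc \<eta> = ball 0 (1 - \<eta>) \<union> {w. - w \<notin> \<real>\<^sub>\<le>\<^sub>0 \<and> Ln (- w) \<in> strip (1 / \<eta>) \<eta>}"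

lemma open_slit_strip: "open {w. - w \<notin> \<real>\<^sub>\<le>\<^sub>0 \<and> Ln (- w) \<in> strip \<Lambda> \<eta>}"
proof -
  let ?D = "{w::complex. - w \<notin> \<real>\<^sub>\<le>\<^sub>0}"
  have "?D = uminus -` (- \<real>\<^sub>\<le>\<^sub>0)" by auto
  then have "open ?D"
    by (simp add: open_vimage continuous_on_minus open_Compl)
  moreover have "continuous_on ?D (\<lambda>w. Ln (- w))"
    by (intro continuous_intros) auto
  ultimately have "open (?D \<inter> (\<lambda>w. Ln (- w)) -` strip \<Lambda> \<eta>)"
    using open_strip by (simp add: continuous_open_preimage)
  moreover have "?D \<inter> (\<lambda>w. Ln (- w)) -` strip \<Lambda> \<eta> = {w. - w \<notin> \<real>\<^sub>\<le>\<^sub>0 \<and> Ln (- w) \<in> strip \<Lambda> \<eta>}"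
    by auto
  ultimately show ?thesis by simp
qed

lemma open_cut_disc: "open (cut_disc \<eta>)"
  unfolding cut_disc_def by (intro open_Un open_ball open_slit_strip)

lemma cut_disc_antimono:
  assumes "0 < \<eta>" "\<eta> \<le> \<eta>'"
  shows "cut_disc \<eta>' \<subseteq> cut_disc \<eta>"
proof -
  have "1 / \<eta>' \<le> 1 / \<eta>" using assms by (intro divide_left_mono) auto
  with assms show ?thesis by (force simp: cut_disc_def strip_def)
qed

lemma in_cut_disc:
  assumes "\<And>t. 1 \<le> t \<Longrightarrow> w \<noteq> of_real t"
  shows "\<exists>n. w \<in> cut_disc (1 / real (n + 2))"
proof (cases "norm w < 1")
  case True
  then obtain n where "inverse (real (Suc n)) < 1 - norm w"
    using reals_Archimedean[of "1 - norm w"] by auto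
  moreover have "1 / real (n + 2) \<le> inverse (real (Suc n))" by (simp add: field_simps)
  ultimately have "norm w < 1 - 1 / real (n + 2)" by linarith
  then show ?thesis by (auto simp: cut_disc_def)
next
  case False
  have w: "- w \<notin> \<real>\<^sub>\<le>\<^sub>0"
  proof
    assume "- w \<in> \<real>\<^sub>\<le>\<^sub>0"
    then obtain x where x: "- w = of_real x" "x \<le> 0" by (blast elim: nonpos_Reals_cases)
    have "norm (- w) = - x" unfolding x(1) using x(2) by simp
    then have "1 \<le> - x" using False by simp
    moreover have "w = of_real (- x)" using arg_cong[OF x(1), of uminus] by simp
    ultimately show False using assms by blast
  qed
  then have "- w \<noteq> 0" by auto
  then have "\<bar>Im (Ln (- w))\<bar> < pi"
    using Im_Ln_less_pi[OF w] mpi_less_Im_Ln[of "- w"] by (simp add: abs_less_iff)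
  then obtain m where m: "inverse (real (Suc m)) < pi - \<bar>Im (Ln (- w))\<bar>"
    using reals_Archimedean[of "pi - \<bar>Im (Ln (- w))\<bar>"] by auto
  obtain k where k: "Re (Ln (- w)) < real k" using reals_Archimedean2 by blast
  let ?n = "max m k"
  have "1 / real (?n + 2) \<le> inverse (real (Suc m))" by (simp add: field_simps)
  with m have "\<bar>Im (Ln (- w))\<bar> < pi - 1 / real (?n + 2)" by linarith
  moreover have "Re (Ln (- w)) < real (?n + 2)" using k by linarith
  ultimately show ?thesis using w by (intro exI[of _ ?n]) (simp add: cut_disc_def strip_def)
qed

text \<open>The regions grow as \<eta> decreases, so a finite subcover reduces to its largest
  member. With \<eta> \<le> 1/2 the disc of convergence has radius at least 1/2, which later allows
  the circle to be fixed before \<eta>.\<close>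

lemma compact_subset_cut_disc:
  assumes "compact Y" "\<And>w t. \<lbrakk>w \<in> Y; 1 \<le> t\<rbrakk> \<Longrightarrow> w \<noteq> of_real t"
  obtains \<eta> where "0 < \<eta>" "\<eta> \<le> 1/2" "Y \<subseteq> cut_disc \<eta>"
proof -
  have "Y \<subseteq> (\<Union>n. cut_disc (1 / real (n + 2)))" using in_cut_disc assms(2) by blast
  then obtain M where M: "finite M" "Y \<subseteq> (\<Union>n\<in>M. cut_disc (1 / real (n + 2)))"
    using compactE_image[OF assms(1), of UNIV "\<lambda>n. cut_disc (1 / real (n + 2))"] open_cut_disc
    by metis
  have "cut_disc (1 / real (n + 2)) \<subseteq> cut_disc (1 / real (Max (insert 0 M) + 2))" if "n \<in> M" for n
    using M(1) that by (intro cut_disc_antimono divide_left_mono) auto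
  with M have "Y \<subseteq> cut_disc (1 / real (Max (insert 0 M) + 2))" by blast
  then show ?thesis by (intro that[of "1 / real (Max (insert 0 M) + 2)"]) auto
qed

section \<open>The kernel of a multiplier\<close>

lemma norm_le_seminorm_S:
  assumes \<gamma>: "\<gamma> \<in> S_space r" and "\<theta> \<in> {0<..<pi/2}" "0 < \<epsilon>" and z: "z \<in> sector \<theta> (r \<theta>)"
  shows "norm (\<gamma> z) \<le> seminorm_S r \<theta> \<epsilon> \<gamma> * exp (\<epsilon> * norm z)"
proof -
  have "bdd_above ((\<lambda>z. norm (\<gamma> z * of_real (exp (- \<epsilon> * norm z)))) ` sector \<theta> (r \<theta>))"
    using assms by (auto simp: S_space_def)
  then have "norm (\<gamma> z * of_real (exp (- \<epsilon> * norm z))) \<le> seminorm_S r \<theta> \<epsilon> \<gamma>"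
    unfolding seminorm_S_def using z by (rule cSUP_upper2) simp
  then have "norm (\<gamma> z) * exp (- (\<epsilon> * norm z)) \<le> seminorm_S r \<theta> \<epsilon> \<gamma>"
    by (simp only: norm_mult norm_of_real abs_exp_cancel) simp
  then show ?thesis by (simp add: exp_minus field_simps)
qed

lemma sector_nonempty: "0 < \<theta> \<Longrightarrow> of_real (\<bar>\<rho>\<bar> + 1) \<in> sector \<theta> \<rho>"
  by (simp add: sector_def Arg_of_real del: of_real_add) linarith

lemma seminorm_S_nonneg:
  assumes "\<gamma> \<in> S_space r" "\<theta> \<in> {0<..<pi/2}" "0 < \<epsilon>"
  shows "0 \<le> seminorm_S r \<theta> \<epsilon> \<gamma>"
proof -
  have "of_real (\<bar>r \<theta>\<bar> + 1) \<in> sector \<theta> (r \<theta>)" using assms by (intro sector_nonempty) auto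
  from order_trans[OF norm_ge_zero norm_le_seminorm_S[OF assms this]] show ?thesis
    by (simp add: zero_le_mult_iff)
qed

lemma S_space_of_nat_eq_0:
  assumes \<gamma>: "\<gamma> \<in> S_space r" and r: "\<And>\<theta>. \<theta> \<in> {0<..<pi/2} \<Longrightarrow> 0 \<le> r \<theta>" and n: "real n \<le> r_zero r"
  shows "\<gamma> (of_nat n) = 0"
proof -
  have "of_nat n \<notin> sector \<theta> (r \<theta>)" if "\<theta> \<in> {0<..<pi/2}" for \<theta>
  proof -
    have "r_zero r \<le> r \<theta>" unfolding r_zero_def using r that by (intro cINF_lower bdd_belowI2) auto
    with n show ?thesis by (auto simp: sector_def)
  qed
  then have "of_nat n \<notin> sector_union r" by (auto simp: sector_union_def)
  with \<gamma> show ?thesis by (simp add: S_space_def)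
qed

lemma of_nat_in_sector:
  assumes "r_zero r < real n"
  obtains \<theta> where "\<theta> \<in> {0<..<pi/2}" "of_nat n \<in> sector \<theta> (r \<theta>)"
proof -
  have "\<exists>\<theta>\<in>{0<..<pi/2}. r \<theta> < real n"
  proof (rule ccontr)
    assume "\<not> ?thesis"
    then have "real n \<le> r \<theta>" if "\<theta> \<in> {0<..<pi/2}" for \<theta>
      using that by (meson not_less)
    moreover have "{0<..<pi/2} \<noteq> {}" using pi_gt_zero by (simp add: not_le)
    ultimately have "real n \<le> r_zero r"
      unfolding r_zero_def by (intro cINF_greatest)
    with assms show False by simp
  qed
  then obtain \<theta> where \<theta>: "\<theta> \<in> {0<..<pi/2}" "r \<theta> < real n" by blast
  then have "of_nat n \<in> sector \<theta> (r \<theta>)"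
    using Arg_of_real[of "real n"] by (cases "n = 0") (auto simp: sector_def Arg_zero)
  with \<theta> show ?thesis by (intro that)
qed

text \<open>Every slope \<tau> is the tangent of an angle below pi/2, so rays as steep as required
  are available; the price is the threshold r(arctan \<tau>).\<close>

lemma cone_beyond_subset_sector:
  assumes "\<rho> \<le> real N - 1" "1 \<le> N"
  shows "cone_beyond N \<tau> \<subseteq> sector (arctan \<tau>) \<rho>"
proof
  fix s assume "s \<in> cone_beyond N \<tau>"
  then have s: "real N - 1 < Re s" "\<bar>Im s\<bar> < \<tau> * Re s" by (auto simp: cone_beyond_def)
  with assms have Re: "0 < Re s" by simp
  have "\<bar>Im s / Re s\<bar> < \<tau>" using s Re by (simp add: abs_divide divide_less_eq)
  then have "- \<tau> < Im s / Re s" "Im s / Re s < \<tau>" by linarith+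
  then have "arctan (- \<tau>) < arctan (Im s / Re s)" "arctan (Im s / Re s) < arctan \<tau>"
    by (auto simp: arctan_less_iff simp del: arctan_minus)
  then have "\<bar>Arg s\<bar> < arctan \<tau>" by (simp add: arg_conv_arctan[OF Re] abs_less_iff arctan_minus)
  moreover have "\<rho> < norm s" using s assms complex_Re_le_cmod[of s] by linarith
  ultimately show "s \<in> sector (arctan \<tau>) \<rho>" by (simp add: sector_def)
qed

lemma Ln_uminus_strip:
  assumes "- w \<notin> \<real>\<^sub>\<le>\<^sub>0"
  shows "- exp (Ln (- w)) = w" "exp (Re (Ln (- w))) = norm w"
proof -
  have "- w \<noteq> 0" using assms by auto
  then show "- exp (Ln (- w)) = w" by simp
  with \<open>- w \<noteq> 0\<close> show "exp (Re (Ln (- w))) = norm w" by (metis norm_exp_eq_Re norm_minus_cancel)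
qed

text \<open>Only the terms with large \<open>n\<close> are continued with a single seminorm; each of the remaining
  indices may lie in no sector but a thin one and costs a seminorm of its own.\<close>

lemma S_space_continuation:
  assumes r: "\<And>\<theta>. \<theta> \<in> {0<..<pi/2} \<Longrightarrow> 0 \<le> r \<theta>" and \<eta>: "0 < \<eta>" "\<eta> < 1"
  obtains F C where "finite F" "F \<subseteq> {0<..<pi/2} \<times> {0<..}" "0 \<le> C"
    "\<And>\<gamma>. \<gamma> \<in> S_space r \<Longrightarrow> \<exists>K. K holomorphic_on cut_disc \<eta> \<and>
       (\<forall>w\<in>cut_disc \<eta>. norm (K w) \<le> C * (\<Sum>(\<theta>, \<epsilon>)\<in>F. seminorm_S r \<theta> \<epsilon> \<gamma>)) \<and>
       (\<forall>w\<in>ball 0 (1 - \<eta>). (\<lambda>n. \<gamma> (of_nat n) * w ^ n) sums K w)"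
proof -
  define \<Lambda> where "\<Lambda> = 1 / \<eta>"
  define \<rho> where "\<rho> = 1 - \<eta>"
  \<comment> \<open>The two demands of the ray estimate: slope at least 4, and \<Lambda> + 2 \<le>
    \<tau> \<eta>.\<close>
  define \<tau> where "\<tau> = max 4 ((\<Lambda> + 2) / \<eta>)"
  define \<theta> where "\<theta> = arctan \<tau>"
  \<comment> \<open>Here \<epsilon>(1 + \<tau>) must be at most 1 along the rays and at most - ln
    \<rho> / 2 on the vertical sides.\<close>
  define \<epsilon> where "\<epsilon> = min 1 (- ln \<rho> / 2) / (1 + \<tau>)"
  \<comment> \<open>Now N - 1 \<ge> r \<theta>, so the cone beyond N lies inside the sector of angle
    \<theta>.\<close>
  define N where "N = nat \<lceil>r \<theta>\<rceil> + 1"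
  \<comment> \<open>Ratio of the geometric series that bounds the tail on the disc; it is below 1
    because \<epsilon> \<le> \<epsilon>(1 + \<tau>) < - ln \<rho>.\<close>
  define q where "q = exp \<epsilon> * \<rho>"
  have \<Lambda>: "0 \<le> \<Lambda>" using \<eta> by (simp add: \<Lambda>_def)
  have \<rho>: "0 < \<rho>" "\<rho> < 1" using \<eta> by (auto simp: \<rho>_def)
  have \<tau>: "4 \<le> \<tau>" by (simp add: \<tau>_def)
  have \<tau>\<eta>: "\<Lambda> + 2 \<le> \<tau> * \<eta>"
  proof -
    have "(\<Lambda> + 2) / \<eta> * \<eta> \<le> \<tau> * \<eta>" using \<eta> by (intro mult_right_mono) (auto simp: \<tau>_def)
    then show ?thesis using \<eta> by simp
  qed
  have \<theta>: "\<theta> \<in> {0<..<pi/2}" using \<tau> arctan_ubound[of \<tau>] by (simp add: \<theta>_def)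
  have ln: "0 < - ln \<rho> / 2" using \<rho> by simp
  have \<epsilon>\<tau>: "\<epsilon> * (1 + \<tau>) = min 1 (- ln \<rho> / 2)" using \<tau> by (simp add: \<epsilon>_def)
  have \<epsilon>: "0 < \<epsilon>" "\<epsilon> * (1 + \<tau>) \<le> 1" "\<epsilon> * (1 + \<tau>) \<le> - ln \<rho> / 2"
    unfolding \<epsilon>\<tau> using \<tau> ln by (auto simp: \<epsilon>_def)
  have N: "1 \<le> N" "r \<theta> \<le> real N - 1"
    by (auto simp: N_def) linarith
  have sub: "cone_beyond N \<tau> \<subseteq> sector \<theta> (r \<theta>)"
    unfolding \<theta>_def using cone_beyond_subset_sector[of "r (arctan \<tau>)" N \<tau>] N by (simp add: \<theta>_def)
  have q: "0 < q" "q < 1"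
  proof -
    have "\<epsilon> * 1 \<le> \<epsilon> * (1 + \<tau>)" using \<epsilon> \<tau> by (intro mult_left_mono) auto
    then have "\<epsilon> < - ln \<rho>" using \<epsilon> ln by linarith
    then have "exp \<epsilon> < exp (- ln \<rho>)" by simp
    then show "q < 1" using \<rho> by (simp add: q_def exp_minus field_simps)
    show "0 < q" using \<rho> by (simp add: q_def)
  qed
  \<comment> \<open>For n \<le> r(0) any angle will do, since \<gamma>(n) = 0 there.\<close>
  have "\<exists>\<theta>. \<theta> \<in> {0<..<pi/2} \<and> (r_zero r < real n \<longrightarrow> of_nat n \<in> sector \<theta> (r \<theta>))" for n
    using of_nat_in_sector[of r n] \<theta> by metis
  then obtain \<theta>n where \<theta>n: "\<And>n. \<theta>n n \<in> {0<..<pi/2}"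
      "\<And>n. r_zero r < real n \<Longrightarrow> of_nat n \<in> sector (\<theta>n n) (r (\<theta>n n))"
    by metis
  define F where "F = insert (\<theta>, \<epsilon>) ((\<lambda>n. (\<theta>n n, 1)) ` {..<N})"
  define C1 where "C1 = (\<Sum>n<N. exp (real n) * exp \<Lambda> ^ n)"
  define C2 where "C2 = 8 * exp (real N * (1 + \<Lambda>)) * (1 + \<tau>)"
  \<comment> \<open>C1 is for the terms below N, C2 for the ray integrals on the logarithmic part,
    and the last summand for the tail on the disc; their sum covers both parts of
    \<open>cut_disc \<eta>\<close>.\<close>
  define C where "C = C1 + C2 + 1 / (1 - q)"
  have F: "finite F" "F \<subseteq> {0<..<pi/2} \<times> {0<..}" using \<theta> \<theta>n \<epsilon> by (auto simp: F_def)
  have C: "0 \<le> C1" "0 \<le> C2" "0 \<le> 1 / (1 - q)" using \<tau> q by (auto simp: C1_def C2_def sum_nonneg)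
  show ?thesis
  proof (rule that[OF F, of C])
    show "0 \<le> C" using C by (simp add: C_def)
    fix \<gamma> assume \<gamma>: "\<gamma> \<in> S_space r"
    define M where "M = (\<Sum>(\<theta>, \<epsilon>)\<in>F. seminorm_S r \<theta> \<epsilon> \<gamma>)"
    have M: "seminorm_S r \<theta>' \<epsilon>' \<gamma> \<le> M" if "(\<theta>', \<epsilon>') \<in> F" for \<theta>' \<epsilon>'
    proof -
      have "(case (\<theta>', \<epsilon>') of (\<theta>, \<epsilon>) \<Rightarrow> seminorm_S r \<theta> \<epsilon> \<gamma>) \<le> M"
        unfolding M_def using F that \<gamma>
        by (intro member_le_sum) (auto intro!: seminorm_S_nonneg)
      then show ?thesis by simp
    qed
    have M0: "0 \<le> M"
      using M[of \<theta> \<epsilon>] seminorm_S_nonneg[OF \<gamma> \<theta> \<epsilon>(1)] by (simp add: F_def)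
    have small: "norm (\<gamma> (of_nat n)) \<le> M * exp (real n)" if "n < N" for n
    proof (cases "r_zero r < real n")
      case True
      have "norm (\<gamma> (of_nat n)) \<le> seminorm_S r (\<theta>n n) 1 \<gamma> * exp (real n)"
        using norm_le_seminorm_S[OF \<gamma> \<theta>n(1) _ \<theta>n(2)[OF True], of 1] by simp
      also have "\<dots> \<le> M * exp (real n)" using that by (intro mult_right_mono M) (auto simp: F_def)
      finally show ?thesis .
    qed (use S_space_of_nat_eq_0[OF \<gamma> r] M0 in auto)
    have large: "norm (\<gamma> s) \<le> M * exp (\<epsilon> * norm s)" if "s \<in> cone_beyond N \<tau>" for s
    proof -
      have "norm (\<gamma> s) \<le> seminorm_S r \<theta> \<epsilon> \<gamma> * exp (\<epsilon> * norm s)"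
        using that sub by (intro norm_le_seminorm_S[OF \<gamma> \<theta> \<epsilon>(1)]) auto
      also have "\<dots> \<le> M * exp (\<epsilon> * norm s)" by (intro mult_right_mono M) (auto simp: F_def)
      finally show ?thesis .
    qed
    interpret cone_function: cone_function \<gamma> N \<tau> \<epsilon> M
    proof
      have "\<gamma> holomorphic_on sector_union r" using \<gamma> by (simp add: S_space_def)
      then show "\<gamma> holomorphic_on cone_beyond N \<tau>"
        by (rule holomorphic_on_subset) (use sub \<theta> in \<open>auto simp: sector_union_def\<close>)
    qed (fact large N(1) \<tau> \<epsilon>(1,2))+
    obtain J where J: "J holomorphic_on strip \<Lambda> \<eta>"
        "\<And>L. L \<in> strip \<Lambda> \<eta> \<Longrightarrow> norm (J L) \<le> C2 * M"
        "\<And>L. \<lbrakk>L \<in> strip \<Lambda> \<eta>; exp (Re L) < \<rho>\<rbrakk> \<Longrightarrow>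
          (\<lambda>k. \<gamma> (of_nat (N + k)) * (- exp L) ^ (N + k)) sums J L"
      by (rule cone_function.power_series_continuation[OF \<Lambda> \<tau>\<eta> \<rho> \<epsilon>(3), folded C2_def])
        (rule that)
    define fin where "fin w = (\<Sum>n<N. \<gamma> (of_nat n) * w ^ n)" for w
    have fin_le: "norm (fin w) \<le> C1 * M" if "norm w \<le> exp \<Lambda>" for w
    proof -
      have "norm (fin w) \<le> (\<Sum>n<N. M * exp (real n) * exp \<Lambda> ^ n)"
        unfolding fin_def using that M0 small
        by (intro sum_norm_le) (auto simp: norm_mult norm_power intro!: mult_mono power_mono)
      then show ?thesis by (simp add: C1_def sum_distrib_left mult_ac)
    qed
    define K1 where "K1 w = (\<Sum>n. \<gamma> (of_nat n) * w ^ n)" for w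
    have tail: "summable (\<lambda>k. \<gamma> (of_nat (k + N)) * w ^ (k + N))"
        "norm (\<Sum>k. \<gamma> (of_nat (k + N)) * w ^ (k + N)) \<le> 1 / (1 - q) * M"
      if w: "norm w < \<rho>" for w
    proof -
      have le: "norm (\<gamma> (of_nat (k + N)) * w ^ (k + N)) \<le> M * q ^ k" for k
      proof -
        have "norm (\<gamma> (of_nat (k + N))) \<le> M * exp (\<epsilon> * norm (of_nat (k + N) :: complex))"
          using N \<tau> by (intro large) (auto simp: cone_beyond_def)
        moreover have "norm (w ^ (k + N)) \<le> \<rho> ^ (k + N)"
          using w by (auto simp: norm_power intro!: power_mono)
        ultimately have "norm (\<gamma> (of_nat (k + N)) * w ^ (k + N))
            \<le> (M * exp (\<epsilon> * norm (of_nat (k + N) :: complex))) * \<rho> ^ (k + N)"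
          unfolding norm_mult by (intro mult_mono) (use M0 in auto)
        also have "\<dots> = M * q ^ (k + N)"
          unfolding norm_of_nat by (simp only: q_def power_mult_distrib exp_of_nat2_mult mult.assoc)
        also have "\<dots> \<le> M * q ^ k"
          using q M0 by (intro mult_left_mono power_decreasing) auto
        finally show ?thesis .
      qed
      have sm: "summable (\<lambda>k. M * q ^ k)" using q by (intro summable_mult summable_geometric) auto
      have smn: "summable (\<lambda>k. norm (\<gamma> (of_nat (k + N)) * w ^ (k + N)))"
        using le by (intro summable_comparison_test'[OF sm]) auto
      then show "summable (\<lambda>k. \<gamma> (of_nat (k + N)) * w ^ (k + N))" by (rule summable_norm_cancel)
      have "norm (\<Sum>k. \<gamma> (of_nat (k + N)) * w ^ (k + N)) \<le> (\<Sum>k. M * q ^ k)"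
        by (rule order_trans[OF summable_norm[OF smn] suminf_le[OF le smn sm]])
      also have "\<dots> = M * (1 / (1 - q))"
        using q by (subst suminf_mult) (auto intro: summable_geometric simp: suminf_geometric)
      finally show "norm (\<Sum>k. \<gamma> (of_nat (k + N)) * w ^ (k + N)) \<le> 1 / (1 - q) * M"
        by (simp add: mult.commute)
    qed
    have sums: "(\<lambda>n. \<gamma> (of_nat n) * w ^ n) sums K1 w"
        "K1 w = fin w + (\<Sum>k. \<gamma> (of_nat (k + N)) * w ^ (k + N))" if "norm w < \<rho>" for w
    proof -
      have "summable (\<lambda>n. \<gamma> (of_nat n) * w ^ n)"
        using tail(1)[OF that] by (subst (asm) summable_iff_shift[of "\<lambda>n. \<gamma> (of_nat n) * w ^ n"])
      note sm = this
      show "(\<lambda>n. \<gamma> (of_nat n) * w ^ n) sums K1 w"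
        unfolding K1_def by (rule summable_sums[OF sm])
      show "K1 w = fin w + (\<Sum>k. \<gamma> (of_nat (k + N)) * w ^ (k + N))"
        unfolding K1_def fin_def suminf_split_initial_segment[OF sm, of N] by (rule add.commute)
    qed
    define A where "A = {w. - w \<notin> \<real>\<^sub>\<le>\<^sub>0 \<and> Ln (- w) \<in> strip \<Lambda> \<eta>}"
    \<comment> \<open>The two expressions agree where both make sense, by \<open>KA\<close>: for |w|
      < \<rho> the ray integrals sum to the tail of the series.\<close>
    define K where "K w = (if norm w < \<rho> then K1 w else fin w + J (Ln (- w)))" for w
    have KA: "K w = fin w + J (Ln (- w))" if "w \<in> A" for w
    proof (cases "norm w < \<rho>")
      case True
      have w: "- w \<notin> \<real>\<^sub>\<le>\<^sub>0" "Ln (- w) \<in> strip \<Lambda> \<eta>" using that by (auto simp: A_def)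
      have "(\<lambda>k. \<gamma> (of_nat (N + k)) * w ^ (N + k)) sums J (Ln (- w))"
        using J(3)[OF w(2)] True Ln_uminus_strip[OF w(1)] by simp
      then show ?thesis
        using True sums(2)[OF True] by (simp add: K_def sums_iff add.commute)
    qed (simp add: K_def)
    have cd: "cut_disc \<eta> = ball 0 \<rho> \<union> A" by (simp add: cut_disc_def \<rho>_def \<Lambda>_def A_def)
    show "\<exists>K. K holomorphic_on cut_disc \<eta> \<and>
       (\<forall>w\<in>cut_disc \<eta>. norm (K w) \<le> C * (\<Sum>(\<theta>, \<epsilon>)\<in>F. seminorm_S r \<theta> \<epsilon> \<gamma>)) \<and>
       (\<forall>w\<in>ball 0 (1 - \<eta>). (\<lambda>n. \<gamma> (of_nat n) * w ^ n) sums K w)"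
      unfolding M_def[symmetric] \<rho>_def[symmetric]
    proof (intro exI[of _ K] conjI ballI)
      show "K holomorphic_on cut_disc \<eta>"
        unfolding cd
      proof (rule holomorphic_on_Un)
        show "open A" unfolding A_def by (rule open_slit_strip)
        have "K1 holomorphic_on ball 0 \<rho>"
          using sums(1) by (intro power_series_holomorphic[of 0 \<rho> "\<lambda>n. \<gamma> (of_nat n)"]) auto
        then show "K holomorphic_on ball 0 \<rho>"
          by (rule holomorphic_transform) (simp add: K_def)
        have "(\<lambda>w. J (Ln (- w))) holomorphic_on A"
          by (rule holomorphic_on_compose_gen[of "\<lambda>w. Ln (- w)" A J "strip \<Lambda> \<eta>", unfolded o_def])
             (use J(1) in \<open>auto simp: A_def intro!: holomorphic_intros\<close>)
        then have "(\<lambda>w. fin w + J (Ln (- w))) holomorphic_on A"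
          unfolding fin_def by (intro holomorphic_intros)
        then show "K holomorphic_on A"
          by (rule holomorphic_transform) (simp add: KA)
      qed simp
      fix w
      show "(\<lambda>n. \<gamma> (of_nat n) * w ^ n) sums K w" if "w \<in> ball 0 \<rho>"
        using that sums(1)[of w] by (simp add: K_def)
      assume "w \<in> cut_disc \<eta>"
      then consider "norm w < \<rho>" | "w \<in> A" by (auto simp: cd)
      then show "norm (K w) \<le> C * M"
      proof cases
        case 1
        have "1 \<le> exp \<Lambda>" using \<Lambda> by simp
        with 1 \<rho> have "norm w \<le> exp \<Lambda>" by linarith
        then have "norm (K1 w) \<le> C1 * M + 1 / (1 - q) * M"
          unfolding sums(2)[OF 1] using tail(2)[OF 1] fin_le[of w] by (intro norm_triangle_mono)
        moreover have "0 \<le> C2 * M" using C M0 by simp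
        ultimately show ?thesis using 1 by (simp add: K_def C_def distrib_right)
      next
        case 2
        then have w: "- w \<notin> \<real>\<^sub>\<le>\<^sub>0" "Ln (- w) \<in> strip \<Lambda> \<eta>" by (auto simp: A_def)
        have "exp (Re (Ln (- w))) \<le> exp \<Lambda>" using w(2) by (simp add: strip_def)
        then have "norm (fin w) \<le> C1 * M"
          using Ln_uminus_strip(2)[OF w(1)] by (intro fin_le) simp
        then have "norm (K w) \<le> C1 * M + C2 * M"
          unfolding KA[OF 2] using J(2)[OF w(2)] by (intro norm_triangle_mono)
        moreover have "0 \<le> 1 / (1 - q) * M" using C M0 by (intro mult_nonneg_nonneg)
        ultimately show ?thesis by (simp add: C_def distrib_right)
      qed
    qed
  qed
qed

section \<open>A contour around a star-shaped set\<close>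

text \<open>The image of the homotopy itself serves as H. A compact H will make the set of quotients
  z/\<zeta> compact, which yields a single \<eta>.\<close>

lemma homotopic_loops_compact:
  fixes p q :: "real \<Rightarrow> 'a::topological_space"
  assumes "homotopic_loops S p q"
  obtains H where "compact H" "H \<subseteq> S" "homotopic_loops H p q"
proof -
  obtain h :: "real \<times> real \<Rightarrow> 'a" where h:
      "continuous_on ({0..1} \<times> {0..1}) h" "h \<in> {0..1} \<times> {0..1} \<rightarrow> S"
      "\<forall>x\<in>{0..1}. h (0, x) = p x" "\<forall>x\<in>{0..1}. h (1, x) = q x"
      "\<forall>t\<in>{0..1}. pathfinish (h \<circ> Pair t) = pathstart (h \<circ> Pair t)"
    using assms unfolding homotopic_loops by blast
  show ?thesis
  proof
    show "compact (h ` ({0..1} \<times> {0..1}))"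
      by (intro compact_continuous_image h compact_Times compact_Icc)
    show "homotopic_loops (h ` ({0..1} \<times> {0..1})) p q"
      unfolding homotopic_loops using h by blast
  qed (use h in blast)
qed

lemma open_thickening: "open (thickening \<delta> U)"
  unfolding thickening_def by (intro open_Collect_less continuous_intros)

lemma subset_thickening: "0 < \<delta> \<Longrightarrow> U \<subseteq> thickening \<delta> U"
  by (auto simp: thickening_def)

lemma bounded_thickening:
  assumes "bounded U" "U \<noteq> {}"
  shows "bounded (thickening \<delta> U :: complex set)"
proof -
  obtain B where B: "\<And>u. u \<in> U \<Longrightarrow> norm u \<le> B" using assms(1) bounded_iff by blast
  have "norm z \<le> \<delta> + B" if z: "z \<in> thickening \<delta> U" for z
  proof -
    have "infdist z U < \<delta>" using z by (simp add: thickening_def)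
    then obtain u where u: "u \<in> U" "dist z u < \<delta>"
      using cINF_greatest[OF assms(2), of \<delta> "dist z"] assms(2)
      by (force simp: infdist_notempty)
    then show ?thesis using B[OF u(1)] norm_triangle_sub[of z u] by (simp add: dist_norm)
  qed
  then show ?thesis unfolding bounded_iff by blast
qed

lemma closure_starlike_at_0:
  fixes U :: "complex set"
  assumes star: "\<And>z. z \<in> U \<Longrightarrow> closed_segment 0 z \<subseteq> U"
    and z: "z \<in> closure U" and t: "0 \<le> t" "t \<le> 1"
  shows "of_real t * z \<in> closure U"
proof -
  have "(\<lambda>w. of_real t * w) ` closure U \<subseteq> closure U"
  proof (rule image_closure_subset)
    show "continuous_on (closure U) (\<lambda>w. of_real t * w)" by (intro continuous_intros)
    have "of_real t * w \<in> U" if "w \<in> U" for w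
    proof -
      have "of_real t * w \<in> closed_segment 0 w"
        using t by (auto simp: in_segment scaleR_conv_of_real)
      then show ?thesis using star[OF that] by blast
    qed
    then show "(\<lambda>w. of_real t * w) ` U \<subseteq> closure U" using closure_subset by blast
  qed simp
  with z show ?thesis by blast
qed

text \<open>The radial function of a star-shaped set need not be continuous; \<open>\<rho>\<close> below is a Lipschitz
  majorant of it, steep enough for the curve \<open>(\<rho> v + \<delta>/2) v\<close>, \<open>\<bar>v\<bar> = 1\<close>, to stay in the
  thickening.\<close>

lemma star_shaped_contour:
  fixes U :: "complex set"
  assumes U: "0 \<in> U" and star: "\<And>z. z \<in> U \<Longrightarrow> closed_segment 0 z \<subseteq> U"
    and B: "0 < B" "\<And>u. u \<in> U \<Longrightarrow> norm u \<le> B" and \<delta>: "0 < \<delta>" and R: "B < R"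
  obtains q H where "valid_path q" "path_image q \<subseteq> thickening \<delta> U"
    "compact H" "H \<inter> closure U = {}" "homotopic_loops H q (circlepath 0 R)"
proof -
  let ?A = "closure U"
  \<comment> \<open>Since \<rho> v \<ge> 0, the penalty at a maximiser u of \<open>h v\<close> is at
    most B. This k then puts u within B/k = \<delta>/4 of the point of equal modulus in direction
    v.\<close>
  define k where "k = 4 * B / \<delta>"
  \<comment> \<open>The modulus of u, penalised for pointing away from v. On the ray through v it
    equals the modulus, so the supremum dominates the radial function; in v it is Lipschitz with
    constant kB for all u, and so is the supremum.\<close>
  define h where "h v u = norm u - k * norm (of_real (norm u) * v - u)" for v u :: complex
  define \<rho> where "\<rho> v = (SUP u\<in>?A. h v u)" for v
  define e where "e t = exp (2 * of_real pi * \<i> * of_real t)" for t :: real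
  define p where "p t = of_real (\<rho> (e t) + \<delta> / 2) * e t" for t
  have k: "0 < k" using B \<delta> by (simp add: k_def)
  have A: "compact ?A" "?A \<noteq> {}" "0 \<in> ?A"
    using B U closure_subset[of U] unfolding compact_closure bounded_iff by auto
  have BA: "norm u \<le> B" if "u \<in> ?A" for u
    using that by (rule continuous_le_on_closure[rotated 1]) (use B in \<open>auto intro: continuous_intros\<close>)
  have hB: "h v u \<le> B" if "u \<in> ?A" for u v
    using BA[OF that] k by (simp add: h_def) (smt (verit) mult_nonneg_nonneg norm_ge_zero)
  have le_\<rho>: "h v u \<le> \<rho> v" if "u \<in> ?A" for u v
    unfolding \<rho>_def using that hB by (intro cSUP_upper bdd_aboveI2) auto
  have \<rho>B: "\<rho> v \<le> B" for v unfolding \<rho>_def using A hB by (intro cSUP_least)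
  have \<rho>0: "0 \<le> \<rho> v" for v using le_\<rho>[OF A(3), of v] by (simp add: h_def)
  have lip: "\<rho> v \<le> \<rho> v' + k * B * norm (v - v')" for v v'
    unfolding \<rho>_def[of v]
  proof (rule cSUP_least[OF A(2)])
    fix u assume u: "u \<in> ?A"
    have "norm (of_real (norm u) * v' - u) \<le>
        norm (of_real (norm u) * v - u) + norm (of_real (norm u) * (v' - v))"
      using norm_triangle_ineq[of "of_real (norm u) * v - u" "of_real (norm u) * (v' - v)"]
      by (simp add: algebra_simps)
    also have "norm (of_real (norm u) * (v' - v)) = norm u * norm (v - v')"
      by (simp add: norm_mult norm_minus_commute)
    also have "\<dots> \<le> B * norm (v - v')" by (intro mult_right_mono BA u) simp
    finally have "k * norm (of_real (norm u) * v' - u) \<le>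
        k * (norm (of_real (norm u) * v - u) + B * norm (v - v'))"
      using k by (intro mult_left_mono) auto
    then have "h v u \<le> h v' u + k * B * norm (v - v')" by (simp add: h_def algebra_simps)
    with le_\<rho>[OF u, of v'] show "h v u \<le> \<rho> v' + k * B * norm (v - v')" by linarith
  qed
  have "(k * B)-lipschitz_on UNIV \<rho>"
  proof (rule lipschitz_onI)
    fix v v'
    show "dist (\<rho> v) (\<rho> v') \<le> k * B * dist v v'"
      using lip[of v v'] lip[of v' v] by (simp add: dist_norm norm_minus_commute)
  qed (use k B in auto)
  then have cont_\<rho>: "continuous_on UNIV \<rho>" by (rule lipschitz_on_continuous_on)
  have cont_e: "continuous_on UNIV e" unfolding e_def by (intro continuous_intros)
  have norm_e: "norm (e t) = 1" for t by (simp add: e_def)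
  have e01: "e 1 = e 0" by (simp add: e_def exp_two_pi_i')
  have notin: "of_real s * v \<notin> ?A" if "\<rho> v < s" "norm v = 1" for s v
  proof
    assume "of_real s * v \<in> ?A"
    from le_\<rho>[OF this, of v] that \<rho>0[of v] show False by (simp add: h_def norm_mult)
  qed
  have near: "of_real (\<rho> v + \<delta> / 2) * v \<in> thickening \<delta> U" if v: "norm v = 1" for v
  proof -
    have "continuous_on ?A (h v)" unfolding h_def by (intro continuous_intros)
    then obtain u where u: "u \<in> ?A" "\<And>u'. u' \<in> ?A \<Longrightarrow> h v u' \<le> h v u"
      using continuous_attains_sup A by metis
    have \<rho>: "\<rho> v = h v u"
      using le_\<rho>[OF u(1)] u A unfolding \<rho>_def by (intro antisym cSUP_least) auto
    have "0 \<le> k * norm (of_real (norm u) * v - u)" using k by simp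
    then have \<rho>u: "\<rho> v \<le> norm u" by (simp add: \<rho> h_def)
    have "k * norm (of_real (norm u) * v - u) \<le> B"
      using \<rho>0[of v] BA[OF u(1)] by (simp add: \<rho> h_def)
    then have d: "norm (of_real (norm u) * v - u) \<le> \<delta> / 4"
      using B \<delta> by (simp add: k_def field_simps)
    \<comment> \<open>Scaling u down to modulus \<rho> v keeps it in the closure by star shape. Its
      distance to the point of the curve is at most \<delta>/4 + \<delta>/2.\<close>
    define s where "s = \<rho> v / norm u"
    have s: "0 \<le> s" "s \<le> 1" using \<rho>0[of v] \<rho>u by (auto simp: s_def divide_le_eq_1)
    have su: "\<rho> v = s * norm u" using \<rho>0[of v] \<rho>u by (auto simp: s_def)
    have "dist (of_real (\<rho> v + \<delta> / 2) * v) (of_real s * u) =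
        norm (of_real s * (of_real (norm u) * v - u) + of_real (\<delta> / 2) * v)"
      by (simp add: dist_norm su algebra_simps)
    also have "\<dots> \<le> s * norm (of_real (norm u) * v - u) + \<delta> / 2"
      using norm_triangle_ineq[of "of_real s * (of_real (norm u) * v - u)" "of_real (\<delta> / 2) * v"]
        s \<delta> v by (simp add: norm_mult)
    also have "s * norm (of_real (norm u) * v - u) \<le> 1 * (\<delta> / 4)"
      using s d by (intro mult_mono) auto
    finally have "dist (of_real (\<rho> v + \<delta> / 2) * v) (of_real s * u) < \<delta>" using \<delta> by simp
    moreover have "of_real s * u \<in> ?A" using closure_starlike_at_0[OF star u(1) s] .
    ultimately obtain u' where u': "u' \<in> U"
        "dist u' (of_real s * u) < \<delta> - dist (of_real (\<rho> v + \<delta> / 2) * v) (of_real s * u)"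
      unfolding closure_approachable by (metis diff_gt_0_iff_gt)
    then have "dist (of_real (\<rho> v + \<delta> / 2) * v) u' < \<delta>"
      using dist_triangle[of "of_real (\<rho> v + \<delta> / 2) * v" u' "of_real s * u"]
      by (simp add: dist_commute)
    then show ?thesis using le_less_trans[OF infdist_le[OF u'(1)]]
      by (simp only: thickening_def mem_Collect_eq)
  qed
  let ?W = "thickening \<delta> U - ?A"
  have cont_p: "continuous_on {0..1} p"
    unfolding p_def
    by (intro continuous_intros continuous_on_compose2[OF cont_\<rho>] continuous_on_subset[OF cont_e]) auto
  then have "path p" by (simp add: path_def)
  have loop_p: "pathfinish p = pathstart p" by (simp add: pathfinish_def pathstart_def p_def e01)
  have "path_image p \<subseteq> ?W"
    using near norm_e notin \<delta> by (auto simp: path_image_def p_def simp del: of_real_add)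
  moreover have "open ?W" using open_thickening by (intro open_Diff) auto
  ultimately obtain d where d: "0 < d" "(\<Union>x\<in>path_image p. cball x d) \<subseteq> ?W"
    using compact_subset_open_imp_cball_epsilon_subset[OF compact_path_image[OF \<open>path p\<close>]] by metis
  \<comment> \<open>Contour integrals need a valid path, while p is only known to be continuous. A
    polynomial loop within d of p stays in \<open>?W\<close> and is joined to p by segments in
    \<open>?W\<close>.\<close>
  obtain q where q: "polynomial_function q" "pathstart q = pathstart p" "pathfinish q = pathfinish p"
      "\<And>t. t \<in> {0..1} \<Longrightarrow> norm (q t - p t) < d"
    using path_approx_polynomial_function[OF \<open>path p\<close> d(1)] by metis
  have vq: "valid_path q" by (rule valid_path_polynomial_function[OF q(1)])
  have seg: "closed_segment (q t) (p t) \<subseteq> ?W" if t: "t \<in> {0..1}" for t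
  proof -
    have "closed_segment (q t) (p t) \<subseteq> cball (p t) d"
      using q(4)[OF t] d(1)
      by (intro closed_segment_subset convex_cball) (auto simp: dist_norm norm_minus_commute)
    moreover have "p t \<in> path_image p" using t by (simp add: path_image_def)
    ultimately show ?thesis using d(2) by blast
  qed
  have "homotopic_loops (- ?A) q p"
    using seg vq q loop_p \<open>path p\<close> by (intro homotopic_loops_linear) (auto simp: valid_path_imp_path)
  moreover have "homotopic_loops (- ?A) p (circlepath 0 R)"
  proof (rule homotopic_loops_linear)
    fix t :: real assume "t \<in> {0..1}"
    have c: "circlepath 0 R t = of_real R * e t" by (simp add: circlepath e_def)
    show "closed_segment (p t) (circlepath 0 R t) \<subseteq> - ?A"
    proof
      fix x assume "x \<in> closed_segment (p t) (circlepath 0 R t)"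
      then obtain u where u: "0 \<le> u" "u \<le> 1" "x = (1 - u) *\<^sub>R p t + u *\<^sub>R circlepath 0 R t"
        by (auto simp: in_segment)
      \<comment> \<open>Both loops are radial over the same direction \<open>e t\<close>, with
        moduli above \<open>\<rho> (e t)\<close>, hence so is every convex combination of
        them.\<close>
      let ?s = "(1 - u) * (\<rho> (e t) + \<delta> / 2) + u * R"
      have "\<rho> (e t) < ?s"
        using convex_bound_lt[of "- (\<rho> (e t) + \<delta> / 2)" "- \<rho> (e t)" "- R" "1 - u" u]
          u \<delta> R \<rho>B[of "e t"] by (simp add: algebra_simps)
      moreover have "x = of_real ?s * e t"
        by (simp add: u(3) c p_def scaleR_conv_of_real algebra_simps)
      ultimately show "x \<in> - ?A" using notin norm_e by blast
    qed
  qed (use \<open>path p\<close> loop_p in auto)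
  ultimately have "homotopic_loops (- ?A) q (circlepath 0 R)" by (rule homotopic_loops_trans)
  then obtain H where H: "compact H" "H \<subseteq> - ?A" "homotopic_loops H q (circlepath 0 R)"
    by (rule homotopic_loops_compact)
  have "path_image q \<subseteq> thickening \<delta> U"
    using seg by (force simp: path_image_def)
  with vq H show ?thesis by (intro that) auto
qed

section \<open>The operator as a contour integral\<close>

abbreviation taylor :: "(complex \<Rightarrow> complex) \<Rightarrow> nat \<Rightarrow> complex" where
  "taylor f n \<equiv> (deriv ^^ n) f 0 / fact n"

lemma entire_sums_taylor:
  assumes "f holomorphic_on UNIV"
  shows "(\<lambda>n. taylor f n * z ^ n) sums f z"
  using holomorphic_power_series[of f 0 "norm z + 1" z] assms
  by (auto intro: holomorphic_on_subset)

lemma entire_from_power_series: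
  assumes "\<And>z. (\<lambda>n. a n * z ^ n) sums f z"
  shows "f holomorphic_on UNIV" "taylor f n = a n"
proof -
  have "f holomorphic_on ball 0 (norm z + 1)" for z :: complex
    using assms by (intro power_series_holomorphic[of 0 _ a]) auto
  then have "f field_differentiable at z" for z
    by (rule holomorphic_on_imp_differentiable_at[of _ "ball 0 (norm z + 1)"]) auto
  then show "f holomorphic_on UNIV" by (simp add: holomorphic_on_def)
  have "f has_fps_expansion Abs_fps a"
    using assms by (intro has_fps_expansionI) simp
  then show "taylor f n = a n" using fps_nth_fps_expansion[of f "Abs_fps a" n] by simp
qed

lemma O_space_holomorphic: "f \<in> O_space r \<Longrightarrow> f holomorphic_on UNIV"
  by (simp add: O_space_def)

lemma O_space_analytic: "f \<in> O_space r \<Longrightarrow> f analytic_on {z}"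
  using O_space_holomorphic analytic_on_holomorphic by blast

lemma O_space_add: "\<lbrakk>f \<in> O_space r; g \<in> O_space r\<rbrakk> \<Longrightarrow> (\<lambda>z. f z + g z) \<in> O_space r"
  by (auto simp: O_space_def higher_deriv_add[of _ UNIV] intro!: holomorphic_intros)

lemma O_space_cmult: "f \<in> O_space r \<Longrightarrow> (\<lambda>z. c * f z) \<in> O_space r"
  by (auto simp: O_space_def higher_deriv_cmult[of _ UNIV] intro!: holomorphic_intros)

lemma zero_in_O_space: "(\<lambda>_. 0) \<in> O_space r"
proof -
  have "(deriv ^^ j) (\<lambda>_. 0::complex) = (\<lambda>_. 0)" for j
    by (induction j) auto
  then show ?thesis by (simp add: O_space_def)
qed

section \<open>Linearity of the multiplier operator and its action on entire functions\<close>

lemma S_space_diff: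
  assumes "\<gamma> \<in> S_space r" "\<gamma>' \<in> S_space r"
  shows "\<gamma> - \<gamma>' \<in> S_space r"
proof -
  have "bdd_above ((\<lambda>z. norm ((\<gamma> - \<gamma>') z * of_real (exp (- \<epsilon> * norm z)))) ` sector \<theta> (r \<theta>))"
    if "\<theta> \<in> {0<..<pi/2}" "0 < \<epsilon>" for \<theta> \<epsilon>
  proof (rule bdd_aboveI2)
    fix z assume z: "z \<in> sector \<theta> (r \<theta>)"
    have "norm ((\<gamma> - \<gamma>') z) \<le> norm (\<gamma> z) + norm (\<gamma>' z)" by (simp add: norm_triangle_ineq4)
    also have "\<dots> \<le> (seminorm_S r \<theta> \<epsilon> \<gamma> + seminorm_S r \<theta> \<epsilon> \<gamma>') * exp (\<epsilon> * norm z)"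
      unfolding distrib_right by (intro add_mono norm_le_seminorm_S assms that z)
    finally show "norm ((\<gamma> - \<gamma>') z * of_real (exp (- \<epsilon> * norm z)))
        \<le> seminorm_S r \<theta> \<epsilon> \<gamma> + seminorm_S r \<theta> \<epsilon> \<gamma>'"
      unfolding norm_mult norm_of_real abs_exp_cancel by (simp add: exp_minus field_simps)
  qed
  moreover have "\<gamma> - \<gamma>' holomorphic_on sector_union r"
    using assms unfolding fun_diff_def by (auto simp: S_space_def intro!: holomorphic_intros)
  ultimately show ?thesis using assms by (simp add: S_space_def)
qed

text \<open>The continuation for \<eta> = 1/2 has a series converging at w = 1/3, so its terms are
  bounded there. This crude growth suffices to keep the image of an entire function entire.\<close>

lemma S_space_of_nat_bound:
  assumes "\<gamma> \<in> S_space r" "\<And>\<theta>. \<theta> \<in> {0<..<pi/2} \<Longrightarrow> 0 \<le> r \<theta>"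
  obtains D where "\<And>n. norm (\<gamma> (of_nat n)) \<le> D * 3 ^ n"
proof -
  obtain K where K: "\<forall>w\<in>ball 0 (1 - 1/2). (\<lambda>n. \<gamma> (of_nat n) * w ^ n) sums K w"
    by (rule S_space_continuation[of r "1/2"], erule assms(2), simp, simp) (use assms(1) in blast)
  then have "(\<lambda>n. \<gamma> (of_nat n) * (1/3) ^ n) sums K (1/3)" by (rule bspec) simp
  then have "Bseq (\<lambda>n. \<gamma> (of_nat n) * (1/3) ^ n)"
    using summable_imp_Bseq sums_summable by blast
  then obtain D where "\<And>n. norm (\<gamma> (of_nat n) * (1/3) ^ n) \<le> D"
    unfolding Bseq_def by blast
  then show ?thesis
    by (intro that[of D]) (simp add: norm_mult norm_power norm_divide field_simps)
qed

lemma H_op_sums: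
  assumes \<gamma>: "\<gamma> \<in> S_space r" and r: "\<And>\<theta>. \<theta> \<in> {0<..<pi/2} \<Longrightarrow> 0 \<le> r \<theta>" and f: "f \<in> O_space r"
  shows "(\<lambda>n. \<gamma> (of_nat n) * taylor f n * z ^ n) sums H_op r \<gamma> f z"
proof -
  obtain D where D: "\<And>n. norm (\<gamma> (of_nat n)) \<le> D * 3 ^ n"
    using S_space_of_nat_bound[OF \<gamma> r] by blast
  \<comment> \<open>Convergence strictly beyond 3|z| gives absolute convergence at 3|z|, and the 3
    absorbs the factor 3^n from the bound on \<gamma>.\<close>
  have "summable (\<lambda>n. taylor f n * (of_real (3 * norm z + 1)) ^ n)"
    using entire_sums_taylor[OF O_space_holomorphic[OF f]] by (rule sums_summable)
  then have "summable (\<lambda>n. norm (taylor f n * (of_real (3 * norm z)) ^ n))"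
    by (rule powser_insidea) (simp del: of_real_add of_real_mult)
  then have sm: "summable (\<lambda>n. D * norm (taylor f n * (of_real (3 * norm z)) ^ n))"
    by (rule summable_mult)
  have le: "norm (\<gamma> (of_nat n) * taylor f n * z ^ n)
      \<le> D * norm (taylor f n * (of_real (3 * norm z)) ^ n)" for n
  proof -
    have "norm (\<gamma> (of_nat n) * taylor f n * z ^ n) = norm (\<gamma> (of_nat n)) * norm (taylor f n * z ^ n)"
      by (simp only: norm_mult mult.assoc)
    also have "\<dots> \<le> D * 3 ^ n * norm (taylor f n * z ^ n)" by (intro mult_right_mono D) simp
    also have "\<dots> = D * norm (taylor f n * (of_real (3 * norm z)) ^ n)"
      by (simp add: norm_mult norm_divide norm_power power_mult_distrib)
    finally show ?thesis .
  qed
  have "summable (\<lambda>n. \<gamma> (of_nat n) * taylor f n * z ^ n)"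
    by (rule summable_comparison_test'[OF sm, of 0]) (rule le)
  moreover have "(if real n > r_zero r then \<gamma> (of_nat n) * taylor f n * z ^ n else 0) =
      \<gamma> (of_nat n) * taylor f n * z ^ n" for n
    using S_space_of_nat_eq_0[OF \<gamma> r] by (simp add: not_less)
  ultimately show ?thesis using f by (simp add: H_op_def summable_sums)
qed

lemma H_op_in_O_space:
  assumes "\<gamma> \<in> S_space r" "\<And>\<theta>. \<theta> \<in> {0<..<pi/2} \<Longrightarrow> 0 \<le> r \<theta>" "f \<in> O_space r"
  shows "H_op r \<gamma> f \<in> O_space r"
proof -
  note * = entire_from_power_series[OF H_op_sums[OF assms]]
  have "taylor f j = 0" if "real j \<le> r_zero r" for j using assms(3) that by (simp add: O_space_def)
  then have "(deriv ^^ j) (H_op r \<gamma> f) 0 = 0" if "real j \<le> r_zero r" for j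
    using *(2)[of j] that by simp
  with *(1) show ?thesis by (simp add: O_space_def)
qed

lemma H_op_eqI:
  assumes "\<gamma> \<in> S_space r" "\<And>\<theta>. \<theta> \<in> {0<..<pi/2} \<Longrightarrow> 0 \<le> r \<theta>" "f \<in> O_space r"
    and "\<And>z. (\<lambda>n. \<gamma> (of_nat n) * taylor f n * z ^ n) sums g z"
  shows "H_op r \<gamma> f = g"
  using H_op_sums[OF assms(1-3)] assms(4) sums_unique2 by blast

lemma H_op_add:
  assumes \<gamma>: "\<gamma> \<in> S_space r" "\<And>\<theta>. \<theta> \<in> {0<..<pi/2} \<Longrightarrow> 0 \<le> r \<theta>" and f: "f \<in> O_space r" and g: "g \<in> O_space r"
  shows "H_op r \<gamma> (\<lambda>z. f z + g z) = (\<lambda>z. H_op r \<gamma> f z + H_op r \<gamma> g z)"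
proof (rule H_op_eqI[OF \<gamma> O_space_add[OF f g]])
  show "(\<lambda>n. \<gamma> (of_nat n) * taylor (\<lambda>z. f z + g z) n * z ^ n) sums (H_op r \<gamma> f z + H_op r \<gamma> g z)" for z
    using sums_add[OF H_op_sums[OF \<gamma> f] H_op_sums[OF \<gamma> g], of z z] f g
    by (simp add: higher_deriv_add_at O_space_analytic algebra_simps add_divide_distrib)
qed

lemma H_op_cmult:
  assumes \<gamma>: "\<gamma> \<in> S_space r" "\<And>\<theta>. \<theta> \<in> {0<..<pi/2} \<Longrightarrow> 0 \<le> r \<theta>" and f: "f \<in> O_space r"
  shows "H_op r \<gamma> (\<lambda>z. c * f z) = (\<lambda>z. c * H_op r \<gamma> f z)"
proof (rule H_op_eqI[OF \<gamma> O_space_cmult[OF f]])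
  show "(\<lambda>n. \<gamma> (of_nat n) * taylor (\<lambda>z. c * f z) n * z ^ n) sums (c * H_op r \<gamma> f z)" for z
    using sums_mult[OF H_op_sums[OF \<gamma> f], of c z] f
    by (simp add: higher_deriv_cmult' O_space_analytic mult_ac)
qed

lemma H_op_diff:
  assumes \<gamma>: "\<gamma> \<in> S_space r" "\<gamma>' \<in> S_space r" and r: "\<And>\<theta>. \<theta> \<in> {0<..<pi/2} \<Longrightarrow> 0 \<le> r \<theta>"
  shows "H_op r (\<gamma> - \<gamma>') = H_op r \<gamma> - H_op r \<gamma>'"
proof
  fix f
  show "H_op r (\<gamma> - \<gamma>') f = (H_op r \<gamma> - H_op r \<gamma>') f"
  proof (cases "f \<in> O_space r")
    case True
    show ?thesis
    proof (rule H_op_eqI[OF S_space_diff[OF \<gamma>] r True])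
      show "(\<lambda>n. (\<gamma> - \<gamma>') (of_nat n) * taylor f n * z ^ n) sums (H_op r \<gamma> - H_op r \<gamma>') f z" for z
        using sums_diff[OF H_op_sums[OF \<gamma>(1) r True] H_op_sums[OF \<gamma>(2) r True], of z z]
        by (simp add: algebra_simps diff_divide_distrib)
    qed
  qed (auto simp: H_op_def fun_eq_iff)
qed

section \<open>Pointwise use of the essential supremum for entire functions\<close>

lemma norm_le_Linf_norm:
  assumes "open V" "bounded V" "f holomorphic_on UNIV" "z \<in> V"
  shows "norm (f z) \<le> Linf_norm V f"
proof -
  have cont: "continuous_on UNIV f" using assms by (intro holomorphic_on_imp_continuous_on)
  have "compact (closure V)" using assms(2) by simp
  then have "bounded (f ` closure V)"
    by (meson cont compact_continuous_image compact_imp_bounded continuous_on_subset subset_UNIV)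
  then have "bdd_above ((\<lambda>z. norm (f z)) ` V)"
    unfolding bounded_iff by (meson bdd_aboveI2 closure_subset imageI subsetD)
  then have "norm (f z) \<le> (SUP z\<in>V. norm (f z))" by (intro cSUP_upper assms)
  then show ?thesis using assms cont by (subst Linf_norm_eq_SUP) auto
qed

lemma Linf_norm_le:
  assumes "open V" "bounded V" "V \<noteq> {}" "f holomorphic_on UNIV" "\<And>z. z \<in> V \<Longrightarrow> norm (f z) \<le> B"
  shows "Linf_norm V f \<le> B"
  using assms by (subst Linf_norm_eq_SUP) (auto intro: cSUP_least holomorphic_on_imp_continuous_on)

lemma Linf_norm_nonneg:
  assumes "open V" "bounded V" "V \<noteq> {}" "f holomorphic_on UNIV"
  shows "0 \<le> Linf_norm V f"
  using assms norm_le_Linf_norm[OF assms(1,2,4)] by (meson equals0I norm_ge_zero order_trans)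

text \<open>Termwise, this is Cauchy's formula for the Taylor coefficients of \<open>f\<close>.\<close>

lemma contour_integral_circlepath_power_series:
  assumes f: "f holomorphic_on UNIV" and R: "0 < R" and z: "norm z < \<rho> * R"
    and K: "\<And>w. norm w < \<rho> \<Longrightarrow> (\<lambda>n. c n * w ^ n) sums K w"
  shows "(\<lambda>n. c n * taylor f n * z ^ n) sums
    (contour_integral (circlepath 0 R) (\<lambda>\<zeta>. K (z / \<zeta>) * f \<zeta> / \<zeta>) / (2 * pi * \<i>))"
proof -
  let ?C = "circlepath 0 R"
  define t where "t n \<zeta> = c n * z ^ n * (f \<zeta> / \<zeta> ^ Suc n)" for n \<zeta>
  have int: "(t n has_contour_integral (c n * z ^ n * (2 * pi * \<i> * taylor f n))) ?C" for n
  proof -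
    have "((\<lambda>u. f u / (u - 0) ^ (Suc n)) has_contour_integral
        ((2 * pi * \<i>) / (fact n) * (deriv ^^ n) f 0)) ?C"
      using f R by (intro Cauchy_has_contour_integral_higher_derivative_circlepath)
        (auto intro: holomorphic_on_imp_continuous_on holomorphic_on_subset)
    from has_contour_integral_lmul[OF this, of "c n * z ^ n"] show ?thesis
      by (simp add: t_def[abs_def])
  qed
  have "bounded (f ` sphere 0 R)"
    using f by (intro compact_imp_bounded compact_continuous_image compact_sphere)
      (auto intro: holomorphic_on_imp_continuous_on holomorphic_on_subset)
  then obtain B where "\<forall>x\<in>f ` sphere 0 R. norm x \<le> B"
    unfolding bounded_iff by blast
  then have B: "norm (f \<zeta>) \<le> B" if "norm \<zeta> = R" for \<zeta>
    using that by simp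
  have zR: "norm z / R < \<rho>" using z R by (simp add: field_simps)
  \<comment> \<open>An intermediate radius turns convergence at \<rho>' into absolute convergence at
    |z|/R, the majorant for the Weierstrass test on the circle.\<close>
  then obtain \<rho>' where \<rho>': "norm z / R < \<rho>'" "\<rho>' < \<rho>" using dense by blast
  have \<rho>'0: "0 < \<rho>'" using \<rho>'(1) R by (smt (verit) divide_nonneg_pos norm_ge_zero)
  have "summable (\<lambda>n. c n * of_real \<rho>' ^ n)"
    using K[of "of_real \<rho>'"] \<rho>' \<rho>'0 by (auto simp: sums_iff)
  then have "summable (\<lambda>n. norm (c n * of_real (norm z / R) ^ n))"
    by (rule powser_insidea) (use \<rho>' \<rho>'0 R in \<open>simp del: of_real_divide\<close>)
  then have sm: "summable (\<lambda>n. norm (c n * of_real (norm z / R) ^ n) * (B / R))"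
    by (rule summable_mult2)
  have le: "norm (t n \<zeta>) \<le> norm (c n * of_real (norm z / R) ^ n) * (B / R)"
    if "\<zeta> \<in> path_image ?C" for n \<zeta>
  proof -
    have \<zeta>: "norm \<zeta> = R" using that R by auto
    have "norm (t n \<zeta>) = norm (c n * of_real (norm z / R) ^ n) * (norm (f \<zeta>) / R)"
      using R by (simp add: t_def norm_mult norm_divide norm_power \<zeta> power_divide)
    also have "\<dots> \<le> norm (c n * of_real (norm z / R) ^ n) * (B / R)"
      using B[OF \<zeta>] R by (intro mult_left_mono divide_right_mono) auto
    finally show ?thesis .
  qed
  have t_sum: "(\<Sum>n. t n \<zeta>) = K (z / \<zeta>) * f \<zeta> / \<zeta>" if "\<zeta> \<in> path_image ?C" for \<zeta>
  proof -
    have \<zeta>: "norm \<zeta> = R" using that R by auto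
    have "(\<lambda>n. c n * (z / \<zeta>) ^ n * (f \<zeta> / \<zeta>)) sums (K (z / \<zeta>) * (f \<zeta> / \<zeta>))"
      using zR by (intro sums_mult2 K) (simp add: norm_divide \<zeta>)
    then show ?thesis by (simp add: sums_iff t_def power_divide mult_ac)
  qed
  have "uniform_limit (path_image ?C) (\<lambda>N \<zeta>. \<Sum>n<N. t n \<zeta>) (\<lambda>\<zeta>. \<Sum>n. t n \<zeta>) sequentially"
    using le sm by (rule Weierstrass_m_test)
  then have ul: "uniform_limit (path_image ?C) (\<lambda>N \<zeta>. \<Sum>n<N. t n \<zeta>) (\<lambda>\<zeta>. K (z / \<zeta>) * f \<zeta> / \<zeta>) sequentially"
    by (rule uniform_limit_cong'[THEN iffD1, rotated -1]) (auto simp: t_sum)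
  have ints: "(\<lambda>\<zeta>. \<Sum>n<N. t n \<zeta>) contour_integrable_on ?C" for N
    using int by (intro contour_integrable_sum) (auto simp: contour_integrable_on_def)
  have "(\<lambda>N. contour_integral ?C (\<lambda>\<zeta>. \<Sum>n<N. t n \<zeta>)) \<longlonglongrightarrow>
      contour_integral ?C (\<lambda>\<zeta>. K (z / \<zeta>) * f \<zeta> / \<zeta>)"
    by (rule contour_integral_uniform_limit(2)[OF always_eventually ul])
       (use ints R in \<open>auto simp: vector_derivative_circlepath norm_mult\<close>)
  moreover have "contour_integral ?C (\<lambda>\<zeta>. \<Sum>n<N. t n \<zeta>) =
      (\<Sum>n<N. c n * z ^ n * (2 * pi * \<i> * taylor f n))" for N
    using int by (intro contour_integral_unique has_contour_integral_sum) auto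
  ultimately have "(\<lambda>n. c n * z ^ n * (2 * pi * \<i> * taylor f n)) sums
      contour_integral ?C (\<lambda>\<zeta>. K (z / \<zeta>) * f \<zeta> / \<zeta>)"
    by (simp add: sums_def)
  from sums_divide[OF this, of "2 * pi * \<i>"] show ?thesis by (simp add: mult_ac)
qed

text \<open>The path, its neighbourhood and \<eta> depend only on U and \<delta>. The multiplier
  enters through the bound for K alone, and f through its supremum on the thickening, so F and C can
  precede \<gamma>, f and z.\<close>

lemma H_op_bound:
  fixes U :: "complex set"
  assumes r: "\<And>\<theta>. \<theta> \<in> {0<..<pi/2} \<Longrightarrow> 0 \<le> r \<theta>"
    and U: "open U" "bounded U" "0 \<in> U" and star: "\<And>z. z \<in> U \<Longrightarrow> closed_segment 0 z \<subseteq> U"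
    and \<delta>: "0 < \<delta>"
  obtains F C where "finite F" "F \<subseteq> {0<..<pi/2} \<times> {0<..}" "0 \<le> C"
    "\<And>\<gamma> f z. \<lbrakk>\<gamma> \<in> S_space r; f \<in> O_space r; z \<in> U\<rbrakk> \<Longrightarrow>
      norm (H_op r \<gamma> f z) \<le> C * (\<Sum>(\<theta>, \<epsilon>)\<in>F. seminorm_S r \<theta> \<epsilon> \<gamma>) * Linf_norm (thickening \<delta> U) f"
proof -
  let ?A = "closure U" and ?V = "thickening \<delta> U"
  obtain B where B: "0 < B" "\<And>u. u \<in> U \<Longrightarrow> norm u \<le> B"
    using U(2) bounded_pos by metis
  \<comment> \<open>With \<eta> \<le> 1/2 as obtained below, |z| \<le> B < (1 - \<eta>) 3B, so
    z/\<zeta> lies in the disc of convergence for all \<zeta> on the circle.\<close>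
  have R: "B < 3 * B" using B by simp
  obtain q H where q: "valid_path q" "path_image q \<subseteq> ?V" and H: "compact H" "H \<inter> ?A = {}"
      and hom: "homotopic_loops H q (circlepath 0 (3 * B))"
    by (rule star_shaped_contour[OF U(3) star B \<delta> R])
  have "open (- ?A)" "H \<subseteq> - ?A" using H by auto
  then obtain e where e: "0 < e" "(\<Union>x\<in>H. cball x e) \<subseteq> - ?A"
    by (rule compact_subset_open_imp_cball_epsilon_subset[OF H(1)])
  \<comment> \<open>The open S carries the holomorphy of the integrand and the homotopy. The larger
    S', a sum of two compact sets, makes the set Y of quotients compact.\<close>
  define S where "S = (\<Union>x\<in>H. ball x e)"
  define S' where "S' = (\<Union>x\<in>H. cball x e)"
  have S: "open S" "H \<subseteq> S" "S \<subseteq> S'" using e(1) by (auto simp: S_def S'_def)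
  have "S' = {x + y |x y. x \<in> H \<and> y \<in> cball 0 e}"
  proof (intro set_eqI iffI)
    fix z assume "z \<in> S'"
    then obtain x where "x \<in> H" "dist x z \<le> e" by (auto simp: S'_def)
    then show "z \<in> {x + y |x y. x \<in> H \<and> y \<in> cball 0 e}"
      by (intro CollectI exI[of _ x] exI[of _ "z - x"]) (simp add: dist_norm norm_minus_commute)
  next
    fix z assume "z \<in> {x + y |x y. x \<in> H \<and> y \<in> cball 0 e}"
    then obtain x y where "z = x + y" "x \<in> H" "norm y \<le> e" by auto
    then show "z \<in> S'" by (auto simp: S'_def dist_norm intro!: bexI[of _ x])
  qed
  then have S'c: "compact S'" using compact_sums[OF H(1) compact_cball[of 0 e]] by (simp only:)
  have S'A: "S' \<inter> ?A = {}" using e(2) by (auto simp: S'_def)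
  have A0: "0 \<in> ?A" using U(3) closure_subset by blast
  then have S'0: "\<zeta> \<noteq> 0" if "\<zeta> \<in> S'" for \<zeta> using that S'A by blast
  define Y where "Y = (\<lambda>(z, \<zeta>). z / \<zeta>) ` (?A \<times> S')"
  have Y: "compact Y"
    unfolding Y_def using S'0 S'c U(2)
    by (intro compact_continuous_image compact_Times)
       (auto simp: case_prod_unfold compact_closure intro!: continuous_intros)
  have Yt: "w \<noteq> of_real t" if wY: "w \<in> Y" and t: "1 \<le> t" for w t
  proof
    assume w: "w = of_real t"
    obtain z \<zeta> where z: "z \<in> ?A" "\<zeta> \<in> S'" "w = z / \<zeta>" using wY by (auto simp: Y_def)
    \<comment> \<open>Star shape enters here: if z/\<zeta> = t \<ge> 1, then \<zeta> = z/t would lie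
      in the closure of U.\<close>
    have "of_real (1 / t) * z = \<zeta>" using z w S'0[OF z(2)] t by (simp add: field_simps)
    moreover have "of_real (1 / t) * z \<in> ?A"
      using t by (intro closure_starlike_at_0[OF star z(1)]) auto
    ultimately show False using z(2) S'A by blast
  qed
  obtain \<eta> where \<eta>: "0 < \<eta>" "\<eta> \<le> 1/2" "Y \<subseteq> cut_disc \<eta>"
    by (rule compact_subset_cut_disc[OF Y Yt])
  have "\<eta> < 1" using \<eta> by simp
  obtain F C where F: "finite F" "F \<subseteq> {0<..<pi/2} \<times> {0<..}" and C: "0 \<le> C"
    and K: "\<And>\<gamma>. \<gamma> \<in> S_space r \<Longrightarrow> \<exists>K. K holomorphic_on cut_disc \<eta> \<and>
       (\<forall>w\<in>cut_disc \<eta>. norm (K w) \<le> C * (\<Sum>(\<theta>, \<epsilon>)\<in>F. seminorm_S r \<theta> \<epsilon> \<gamma>)) \<and>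
       (\<forall>w\<in>ball 0 (1 - \<eta>). (\<lambda>n. \<gamma> (of_nat n) * w ^ n) sums K w)"
    by (rule S_space_continuation[of r \<eta>], erule r, rule \<eta>(1), rule \<open>\<eta> < 1\<close>) (rule that)
  \<comment> \<open>S' avoids U and hence this disc, which bounds the factor 1/\<zeta> by
    1/d.\<close>
  obtain d where d: "0 < d" "ball 0 d \<subseteq> U" using U open_contains_ball by blast
  have dS: "d \<le> norm \<zeta>" if "\<zeta> \<in> S'" for \<zeta>
  proof (rule ccontr)
    assume "\<not> d \<le> norm \<zeta>"
    then have "\<zeta> \<in> U" using d(2) by (auto simp: subset_iff)
    then show False using that S'A closure_subset by blast
  qed
  have "path_image q \<subseteq> S \<inter> ?V" "open (S \<inter> ?V)"
    using homotopic_loops_imp_subset[OF hom] S q(2) open_thickening by auto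
  \<comment> \<open>L takes the place of the length of q; it depends only on q and the open set
    \<open>S \<inter> ?V\<close>, not on the integrand.\<close>
  then obtain L where L: "0 < L" "\<And>h B. \<lbrakk>h holomorphic_on S \<inter> ?V; \<forall>z\<in>S \<inter> ?V. norm (h z) \<le> B\<rbrakk>
      \<Longrightarrow> norm (contour_integral q h) \<le> L * B"
    using contour_integral_bound_exists[OF _ q(1)] by metis
  have V: "open ?V" "bounded ?V" using open_thickening bounded_thickening U by auto
  show ?thesis
  proof (rule that[OF F, of "L * C / (d * (2 * pi))"])
    show "0 \<le> L * C / (d * (2 * pi))" using L C d by simp
    fix \<gamma> f z assume \<gamma>: "\<gamma> \<in> S_space r" and f: "f \<in> O_space r" and z: "z \<in> U"
    define M where "M = (\<Sum>(\<theta>, \<epsilon>)\<in>F. seminorm_S r \<theta> \<epsilon> \<gamma>)"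
    obtain K where K: "K holomorphic_on cut_disc \<eta>" "\<And>w. w \<in> cut_disc \<eta> \<Longrightarrow> norm (K w) \<le> C * M"
        "\<And>w. w \<in> ball 0 (1 - \<eta>) \<Longrightarrow> (\<lambda>n. \<gamma> (of_nat n) * w ^ n) sums K w"
      using K[OF \<gamma>] unfolding M_def by blast
    let ?h = "\<lambda>\<zeta>. K (z / \<zeta>) * f \<zeta> / \<zeta>"
    have cd: "z / \<zeta> \<in> cut_disc \<eta>" if "\<zeta> \<in> S" for \<zeta>
    proof -
      have "z / \<zeta> \<in> Y" unfolding Y_def using that z S(3) closure_subset[of U] by force
      then show ?thesis using \<eta>(3) by blast
    qed
    have fhol: "f holomorphic_on A" for A
      using O_space_holomorphic[OF f] by (rule holomorphic_on_subset) simp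
    have "(\<lambda>\<zeta>. K (z / \<zeta>)) holomorphic_on S"
      by (rule holomorphic_on_compose_gen[of "\<lambda>\<zeta>. z / \<zeta>" S K "cut_disc \<eta>", unfolded o_def])
         (use cd K(1) S S'0 in \<open>auto intro!: holomorphic_intros\<close>)
    then have hol: "?h holomorphic_on S"
      using fhol S S'0 by (intro holomorphic_intros) auto
    have "(\<lambda>n. \<gamma> (of_nat n) * taylor f n * z ^ n) sums
        (contour_integral (circlepath 0 (3 * B)) ?h / (2 * pi * \<i>))"
    proof (rule contour_integral_circlepath_power_series[OF O_space_holomorphic[OF f]])
      show "norm z < (1 - \<eta>) * (3 * B)"
      proof -
        have "1/2 * (3 * B) \<le> (1 - \<eta>) * (3 * B)" using \<eta> B by (intro mult_right_mono) auto
        then show ?thesis using B(2)[OF z] B(1) by linarith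
      qed
    qed (use B K(3) in auto)
    moreover have "contour_integral q ?h = contour_integral (circlepath 0 (3 * B)) ?h"
      by (rule Cauchy_theorem_homotopic_loops[OF homotopic_loops_subset[OF hom S(2)] S(1) hol q(1)]) simp
    ultimately have "(\<lambda>n. \<gamma> (of_nat n) * taylor f n * z ^ n) sums
        (contour_integral q ?h / (2 * pi * \<i>))"
      by (simp only:)
    with H_op_sums[OF \<gamma> r f]
    have eq: "H_op r \<gamma> f z = contour_integral q ?h / (2 * pi * \<i>)"
      by (rule sums_unique2)
    have "norm (contour_integral q ?h) \<le> L * (C * M * Linf_norm ?V f / d)"
    proof (rule L(2))
      show "?h holomorphic_on S \<inter> ?V" using hol by (rule holomorphic_on_subset) simp
      show "\<forall>\<zeta>\<in>S \<inter> ?V. norm (?h \<zeta>) \<le> C * M * Linf_norm ?V f / d"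
      proof
        fix \<zeta> assume \<zeta>: "\<zeta> \<in> S \<inter> ?V"
        have 1: "norm (K (z / \<zeta>)) \<le> C * M" using \<zeta> cd by (intro K(2)) simp
        have 2: "norm (f \<zeta>) \<le> Linf_norm ?V f"
          using \<zeta> V fhol by (intro norm_le_Linf_norm) auto
        have 3: "d \<le> norm \<zeta>" using \<zeta> S(3) dS by blast
        show "norm (?h \<zeta>) \<le> C * M * Linf_norm ?V f / d"
          unfolding norm_mult norm_divide
          using order_trans[OF norm_ge_zero 1] order_trans[OF norm_ge_zero 2] d(1)
            mult_nonneg_nonneg[OF order_trans[OF norm_ge_zero 1] order_trans[OF norm_ge_zero 2]]
          by (intro frac_le mult_mono 1 2 3) auto
      qed
    qed
    then show "norm (H_op r \<gamma> f z) \<le> L * C / (d * (2 * pi)) * (\<Sum>(\<theta>, \<epsilon>)\<in>F. seminorm_S r \<theta> \<epsilon> \<gamma>) * Linf_norm ?V f"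
      unfolding eq M_def[symmetric] using d(1) by (simp add: norm_divide norm_mult field_simps)
  qed
qed

section \<open>Continuity\<close>

lemma topspace_seminorm_topology:
  assumes "P \<noteq> {}" "\<And>x p. \<lbrakk>x \<in> X; p \<in> P\<rbrakk> \<Longrightarrow> p (x - x) = 0"
  shows "topspace (seminorm_topology X P) = X"
proof -
  obtain p where p: "p \<in> P" using assms(1) by blast
  have "x \<in> {y \<in> X. p (y - x) < 1}" if "x \<in> X" for x using assms(2)[OF that p] that by simp
  with p show ?thesis
    unfolding seminorm_topology_def topology_generated_by_topspace
    by (blast intro: zero_less_one)
qed

lemma openin_seminorm_ball:
  assumes "p \<in> P" "x \<in> X" "0 < e"
  shows "openin (seminorm_topology X P) {y \<in> X. p (y - x) < e}"
  unfolding seminorm_topology_def using assms by (intro topology_generated_by_Basis) blast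

text \<open>A finite intersection of subbasic balls about x is a neighbourhood of x, so linear
  control by finitely many members of P is enough.\<close>

lemma continuous_map_seminorm_topology_real:
  fixes g :: "'v::minus \<Rightarrow> real"
  assumes P: "P \<noteq> {}" "\<And>x p. \<lbrakk>x \<in> X; p \<in> P\<rbrakk> \<Longrightarrow> p (x - x) = 0"
    and F: "finite F" "\<And>i. i \<in> F \<Longrightarrow> p i \<in> P" and C: "0 \<le> C"
    and le: "\<And>x y. \<lbrakk>x \<in> X; y \<in> X\<rbrakk> \<Longrightarrow> \<bar>g y - g x\<bar> \<le> C * (\<Sum>i\<in>F. p i (y - x))"
  shows "continuous_map (seminorm_topology X P) euclideanreal g"
proof -
  let ?T = "seminorm_topology X P"
  have top: "topspace ?T = X" by (rule topspace_seminorm_topology) (fact P)+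
  have openX: "openin ?T X" using openin_topspace[of ?T] top by simp
  have "openin ?T {x \<in> X. g x \<in> U}" if "open U" for U
  proof (subst openin_subopen, intro ballI)
    fix x assume "x \<in> {x \<in> X. g x \<in> U}"
    then have x: "x \<in> X" "g x \<in> U" by auto
    obtain e where e: "0 < e" "\<And>t. dist t (g x) < e \<Longrightarrow> t \<in> U"
      using \<open>open U\<close> x(2) unfolding open_dist by blast
    \<comment> \<open>The summand 1 keeps the denominator positive when C is 0 or F is
      empty.\<close>
    define e' where "e' = e / (C * card F + 1)"
    have D: "0 < C * card F + 1" using C by (simp add: add_nonneg_pos)
    have e': "0 < e'" using e D by (simp add: e'_def)
    let ?N = "(\<Inter>i\<in>F. {y \<in> X. p i (y - x) < e'}) \<inter> X"
    have "openin ?T ?N"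
    proof (cases "F = {}")
      case False
      then have "openin ?T (\<Inter>i\<in>F. {y \<in> X. p i (y - x) < e'})"
        using F x e' by (intro openin_INT2) (auto intro!: openin_seminorm_ball)
      then show ?thesis using openX by (rule openin_Int)
    qed (use openX in simp)
    moreover have "x \<in> ?N" using x e' P(2)[OF x(1) F(2)] by auto
    moreover have "?N \<subseteq> {x \<in> X. g x \<in> U}"
    proof
      fix y assume y: "y \<in> ?N"
      have "\<bar>g y - g x\<bar> \<le> C * (\<Sum>i\<in>F. p i (y - x))" using x y by (intro le) auto
      also have "\<dots> \<le> C * (card F * e')"
        using y C by (intro mult_left_mono sum_bounded_above) (auto intro: less_imp_le)
      also have "\<dots> < (C * card F + 1) * e'" using e' by (simp add: algebra_simps)
      also have "\<dots> = e" using D by (simp add: e'_def)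
      finally show "y \<in> {x \<in> X. g x \<in> U}" using y e(2)[of "g y"] by (simp add: dist_real_def)
    qed
    ultimately show "\<exists>T. openin ?T T \<and> x \<in> T \<and> T \<subseteq> {x \<in> X. g x \<in> U}" by blast
  qed
  then show ?thesis by (simp add: continuous_map_def top)
qed

lemma seminorm_S_diff_self:
  assumes "\<theta> \<in> {0<..<pi/2}"
  shows "seminorm_S r \<theta> \<epsilon> (\<gamma> - \<gamma>) = 0"
proof -
  have "sector \<theta> (r \<theta>) \<noteq> {}" using sector_nonempty[of \<theta> "r \<theta>"] assms by auto
  then show ?thesis by (simp add: seminorm_S_def)
qed

section \<open>Operator norms between two spaces with supremum norms\<close>

locale Linf_domains =
  fixes V W :: "complex set" and r :: "real \<Rightarrow> real"
  assumes V: "open V" "bounded V" "V \<noteq> {}" and W: "open W" "bounded W" "W \<noteq> {}"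
begin

text \<open>It keeps the part of \<open>bounded_ops\<close> on which the norm estimates rest, so
  closure under differences involves no linearity.\<close>

definition bdd_op :: "((complex \<Rightarrow> complex) \<Rightarrow> complex \<Rightarrow> complex) \<Rightarrow> bool" where
  "bdd_op T \<longleftrightarrow> (\<forall>f\<in>O_space r. T f holomorphic_on UNIV) \<and>
     (\<exists>K. \<forall>f\<in>O_space r. Linf_norm W (T f) \<le> K * Linf_norm V f)"

lemma V_nonneg: "f \<in> O_space r \<Longrightarrow> 0 \<le> Linf_norm V f"
  by (intro Linf_norm_nonneg V O_space_holomorphic)

lemma Linf_norm_triangle:
  assumes "f holomorphic_on UNIV" "g holomorphic_on UNIV" "\<And>z. norm (h z) \<le> norm (f z) + norm (g z)"
    and "h holomorphic_on UNIV"
  shows "Linf_norm W h \<le> Linf_norm W f + Linf_norm W g"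
proof (rule Linf_norm_le[OF W assms(4)])
  fix z assume "z \<in> W"
  then show "norm (h z) \<le> Linf_norm W f + Linf_norm W g"
    using assms(3)[of z] norm_le_Linf_norm[OF W(1,2) assms(1)] norm_le_Linf_norm[OF W(1,2) assms(2)]
    by force
qed

lemma bdd_op_diff:
  assumes "bdd_op S" "bdd_op T"
  shows "bdd_op (S - T)"
proof -
  obtain K K' where K: "\<And>f. f \<in> O_space r \<Longrightarrow> Linf_norm W (S f) \<le> K * Linf_norm V f"
      "\<And>f. f \<in> O_space r \<Longrightarrow> Linf_norm W (T f) \<le> K' * Linf_norm V f"
    using assms unfolding bdd_op_def by blast
  have hol: "S f holomorphic_on UNIV" "T f holomorphic_on UNIV" "(S - T) f holomorphic_on UNIV"
    if "f \<in> O_space r" for f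
  proof -
    show *: "S f holomorphic_on UNIV" "T f holomorphic_on UNIV"
      using assms that unfolding bdd_op_def by auto
    have "(S - T) f = (\<lambda>z. S f z - T f z)" by (simp add: fun_eq_iff)
    with * show "(S - T) f holomorphic_on UNIV" by (auto intro!: holomorphic_intros)
  qed
  have "Linf_norm W ((S - T) f) \<le> (K + K') * Linf_norm V f" if f: "f \<in> O_space r" for f
  proof -
    have "Linf_norm W ((S - T) f) \<le> Linf_norm W (S f) + Linf_norm W (T f)"
      by (rule Linf_norm_triangle[OF hol(1,2)[OF f] _ hol(3)[OF f]]) (simp add: norm_triangle_ineq4)
    with K[OF f] show ?thesis by (simp add: distrib_right)
  qed
  with hol show ?thesis unfolding bdd_op_def by blast
qed

lemma op_norm_le:
  assumes "0 \<le> c" "\<And>f. f \<in> O_space r \<Longrightarrow> Linf_norm W (T f) \<le> c * Linf_norm V f"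
  shows "op_norm r V W T \<le> c"
  unfolding op_norm_def
proof (rule cSUP_least)
  show "O_space r \<noteq> {}" using zero_in_O_space by blast
  fix f assume f: "f \<in> O_space r"
  \<comment> \<open>A vanishing denominator makes the quotient 0, which is at most c because c \<ge>
    0.\<close>
  show "Linf_norm W (T f) / Linf_norm V f \<le> c"
    using assms(1) assms(2)[OF f] V_nonneg[OF f]
    by (cases "Linf_norm V f = 0") (auto simp: divide_le_eq)
qed

lemma bdd_above_quotients:
  assumes "bdd_op T"
  shows "bdd_above ((\<lambda>f. Linf_norm W (T f) / Linf_norm V f) ` O_space r)"
proof -
  obtain K where K: "\<And>f. f \<in> O_space r \<Longrightarrow> Linf_norm W (T f) \<le> K * Linf_norm V f"
    using assms unfolding bdd_op_def by blast
  show ?thesis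
  proof (rule bdd_aboveI2)
    fix f assume f: "f \<in> O_space r"
    have "Linf_norm W (T f) \<le> \<bar>K\<bar> * Linf_norm V f"
      using K[OF f] mult_right_mono[OF abs_ge_self V_nonneg[OF f], of K] by linarith
    then show "Linf_norm W (T f) / Linf_norm V f \<le> \<bar>K\<bar>"
      using V_nonneg[OF f] by (cases "Linf_norm V f = 0") (auto simp: divide_le_eq)
  qed
qed

lemma le_op_norm:
  assumes T: "bdd_op T" and f: "f \<in> O_space r"
  shows "Linf_norm W (T f) \<le> op_norm r V W T * Linf_norm V f"
proof (cases "Linf_norm V f = 0")
  case True
  \<comment> \<open>Here the quotient is 0 by convention and carries no information; the bound K * 0
    supplies the estimate directly.\<close>
  with T f show ?thesis unfolding bdd_op_def by fastforce
next
  case False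
  have "Linf_norm W (T f) / Linf_norm V f \<le> op_norm r V W T"
    unfolding op_norm_def using f by (intro cSUP_upper bdd_above_quotients T)
  then show ?thesis using False V_nonneg[OF f] by (simp add: divide_le_eq)
qed

lemma op_norm_nonneg:
  assumes "bdd_op T"
  shows "0 \<le> op_norm r V W T"
proof -
  have "0 \<le> Linf_norm W (T (\<lambda>_. 0)) / Linf_norm V (\<lambda>_. 0)"
    using assms zero_in_O_space unfolding bdd_op_def
    by (intro divide_nonneg_nonneg V_nonneg Linf_norm_nonneg W) auto
  then show ?thesis
    unfolding op_norm_def by (rule cSUP_upper2[OF bdd_above_quotients[OF assms] zero_in_O_space])
qed

lemma op_norm_triangle:
  assumes "bdd_op S" "bdd_op T"
  shows "op_norm r V W S \<le> op_norm r V W T + op_norm r V W (S - T)"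
proof (rule op_norm_le)
  have d: "bdd_op (S - T)" by (rule bdd_op_diff[OF assms])
  show "0 \<le> op_norm r V W T + op_norm r V W (S - T)"
    using op_norm_nonneg[OF assms(2)] op_norm_nonneg[OF d] by simp
  fix f assume f: "f \<in> O_space r"
  have "norm (S f z) \<le> norm (T f z) + norm ((S - T) f z)" for z
    using norm_triangle_sub[of "S f z" "T f z"] by simp
  then have "Linf_norm W (S f) \<le> Linf_norm W (T f) + Linf_norm W ((S - T) f)"
    using assms d f unfolding bdd_op_def by (intro Linf_norm_triangle) auto
  with le_op_norm[OF assms(2) f] le_op_norm[OF d f]
  show "Linf_norm W (S f) \<le> (op_norm r V W T + op_norm r V W (S - T)) * Linf_norm V f"
    by (simp add: distrib_right)
qed

lemma bounded_ops_imp_bdd_op: "T \<in> bounded_ops r V W \<Longrightarrow> bdd_op T"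
  unfolding bounded_ops_def bdd_op_def using O_space_holomorphic by blast

end

theorem theorem18:
  fixes r :: "real \<Rightarrow> real" and U :: "complex set" and \<delta> :: real
  assumes "\<And>\<theta>. \<theta> \<in> {0<..<pi/2} \<Longrightarrow> 0 \<le> r \<theta>"
    and "mono_on {0<..<pi/2} r"
    and "open U" and "bounded U" and "connected U"
    and "0 \<in> U" and "\<And>z. z \<in> U \<Longrightarrow> closed_segment 0 z \<subseteq> U"
    and "0 < \<delta>"
  shows "(\<forall>\<gamma>\<in>S_space r. \<exists>C>0. \<forall>p :: complex poly. poly p \<in> O_space r \<longrightarrow>
            Linf_norm U (H_op r \<gamma> (poly p)) \<le> C * Linf_norm (thickening \<delta> U) (poly p))
       \<and> (\<exists>C. continuous_map (S_topology r) euclideanreal C \<and>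
            (\<forall>\<gamma>\<in>S_space r. C \<gamma> > 0 \<and> (\<forall>p :: complex poly. poly p \<in> O_space r \<longrightarrow>
              Linf_norm U (H_op r \<gamma> (poly p)) \<le> C \<gamma> * Linf_norm (thickening \<delta> U) (poly p))))
       \<and> continuous_map (S_topology r) (op_topology r (thickening \<delta> U) U) (H_op r)"
proof -
  let ?V = "thickening \<delta> U" and ?H = "H_op r"
  note r = assms(1)
  have "U \<noteq> {}" using assms by blast
  interpret Linf_domains ?V U r
  proof
    show "open ?V" by (rule open_thickening)
    show "bounded ?V" by (rule bounded_thickening[OF assms(4) \<open>U \<noteq> {}\<close>])
    show "?V \<noteq> {}" using subset_thickening[OF assms(8), of U] \<open>U \<noteq> {}\<close> by blast
  qed (fact assms(3) assms(4) \<open>U \<noteq> {}\<close>)+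
  obtain F C where F: "finite F" "F \<subseteq> {0<..<pi/2} \<times> {0<..}" and C: "0 \<le> C"
    and bound: "\<And>\<gamma> f z. \<lbrakk>\<gamma> \<in> S_space r; f \<in> O_space r; z \<in> U\<rbrakk> \<Longrightarrow>
      norm (?H \<gamma> f z) \<le> C * (\<Sum>(\<theta>, \<epsilon>)\<in>F. seminorm_S r \<theta> \<epsilon> \<gamma>) * Linf_norm ?V f"
    by (rule H_op_bound[of r U \<delta>], erule assms(1), rule assms(3), rule assms(4), rule assms(6),
        erule assms(7), rule assms(8)) (rule that)
  define p where "p i = (case i of (\<theta>, \<epsilon>) \<Rightarrow> seminorm_S r \<theta> \<epsilon>)" for i
  have p: "(\<Sum>(\<theta>, \<epsilon>)\<in>F. seminorm_S r \<theta> \<epsilon> \<gamma>) = (\<Sum>i\<in>F. p i \<gamma>)" for \<gamma>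
    by (intro sum.cong) (auto simp: p_def)
  have p0: "0 \<le> (\<Sum>i\<in>F. p i \<gamma>)" if "\<gamma> \<in> S_space r" for \<gamma>
    using that F(2) by (intro sum_nonneg) (auto simp: p_def intro!: seminorm_S_nonneg)
  have Linf: "Linf_norm U (?H \<gamma> f) \<le> C * (\<Sum>i\<in>F. p i \<gamma>) * Linf_norm ?V f"
    if "\<gamma> \<in> S_space r" "f \<in> O_space r" for \<gamma> f
    using that bound O_space_holomorphic[OF H_op_in_O_space[OF that(1) r that(2)]]
    by (intro Linf_norm_le W) (auto simp: p)
  have H: "?H \<gamma> \<in> bounded_ops r ?V U" if \<gamma>: "\<gamma> \<in> S_space r" for \<gamma>
  proof -
    have "?H \<gamma> f = (\<lambda>_. 0)" if "f \<notin> O_space r" for f using that by (simp add: H_op_def)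
    then show ?thesis
      unfolding bounded_ops_def
      by (intro CollectI conjI ballI allI impI exI[of _ "C * (\<Sum>i\<in>F. p i \<gamma>)"]
          H_op_in_O_space[OF \<gamma> r] H_op_add[OF \<gamma> r] H_op_cmult[OF \<gamma> r] Linf[OF \<gamma>])
  qed
  note Hb = bounded_ops_imp_bdd_op[OF H]
  have op_le: "op_norm r ?V U (?H \<gamma> - ?H \<gamma>') \<le> C * (\<Sum>i\<in>F. p i (\<gamma> - \<gamma>'))"
    if "\<gamma> \<in> S_space r" "\<gamma>' \<in> S_space r" for \<gamma> \<gamma>'
  proof -
    have d: "\<gamma> - \<gamma>' \<in> S_space r" by (rule S_space_diff[OF that])
    have "op_norm r ?V U (?H (\<gamma> - \<gamma>')) \<le> C * (\<Sum>i\<in>F. p i (\<gamma> - \<gamma>'))"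
      by (intro op_norm_le mult_nonneg_nonneg C p0[OF d] Linf[OF d])
    then show ?thesis by (simp only: H_op_diff[OF that r])
  qed
  have sym: "p i (\<gamma> - \<gamma>') = p i (\<gamma>' - \<gamma>)" for i \<gamma> \<gamma>'
    by (simp add: p_def seminorm_S_def norm_mult norm_minus_commute split: prod.split)
  \<comment> \<open>The distance to an arbitrary T is treated, not just the norm: subbasic open sets
    of the operator topology are balls about any T, and their preimages are sublevel sets of this
    function.\<close>
  have cont: "continuous_map (S_topology r) euclideanreal (\<lambda>\<gamma>. op_norm r ?V U (?H \<gamma> - T))"
    if T: "bdd_op T" for T
    unfolding S_topology_def
  proof (rule continuous_map_seminorm_topology_real[OF _ _ F(1) _ C])
    show "{seminorm_S r \<theta> \<epsilon> |\<theta> \<epsilon>. \<theta> \<in> {0<..<pi/2} \<and> 0 < \<epsilon>} \<noteq> {}"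
    proof -
      have "pi / 4 \<in> {0<..<pi/2}" by simp
      then show ?thesis using zero_less_one by blast
    qed
    show "q (\<gamma> - \<gamma>) = 0" if "q \<in> {seminorm_S r \<theta> \<epsilon> |\<theta> \<epsilon>. \<theta> \<in> {0<..<pi/2} \<and> 0 < \<epsilon>}" for q \<gamma>
      using that seminorm_S_diff_self by blast
    show "p i \<in> {seminorm_S r \<theta> \<epsilon> |\<theta> \<epsilon>. \<theta> \<in> {0<..<pi/2} \<and> 0 < \<epsilon>}" if "i \<in> F" for i
    proof -
      have "fst i \<in> {0<..<pi/2}" "0 < snd i" using that F(2) by auto
      then show ?thesis by (auto simp: p_def case_prod_unfold)
    qed
    fix \<gamma> \<gamma>' assume \<gamma>: "\<gamma> \<in> S_space r" "\<gamma>' \<in> S_space r"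
    have *: "op_norm r ?V U (?H a - T) \<le> op_norm r ?V U (?H b - T) + op_norm r ?V U (?H a - ?H b)"
      if "a \<in> S_space r" "b \<in> S_space r" for a b
    proof -
      have "(?H a - T) - (?H b - T) = ?H a - ?H b" by (simp add: fun_eq_iff)
      then show ?thesis
        using op_norm_triangle[OF bdd_op_diff[OF Hb T] bdd_op_diff[OF Hb T], OF that] by simp
    qed
    show "\<bar>op_norm r ?V U (?H \<gamma>' - T) - op_norm r ?V U (?H \<gamma> - T)\<bar> \<le> C * (\<Sum>i\<in>F. p i (\<gamma>' - \<gamma>))"
      using *[OF \<gamma>] *[OF \<gamma>(2,1)] op_le[OF \<gamma>] op_le[OF \<gamma>(2,1)] by (simp add: sym[of _ \<gamma> \<gamma>'])
  qed
  have top: "topspace (S_topology r) = S_space r"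
  proof -
    have "pi / 4 \<in> {0<..<pi/2}" by simp
    then have "{seminorm_S r \<theta> \<epsilon> |\<theta> \<epsilon>. \<theta> \<in> {0<..<pi/2} \<and> 0 < \<epsilon>} \<noteq> {}" using zero_less_one by blast
    then show ?thesis
      unfolding S_topology_def using seminorm_S_diff_self by (intro topspace_seminorm_topology) auto
  qed
  \<comment> \<open>The distance from the zero operator is the operator norm, so \<open>cont\<close>
    also gives continuity of the norm.\<close>
  define Z :: "(complex \<Rightarrow> complex) \<Rightarrow> complex \<Rightarrow> complex" where "Z = (\<lambda>_ _. 0)"
  have Z0: "Linf_norm U (Z f) = 0" for f
    using W by (simp add: Z_def Linf_norm_eq_SUP)
  have "bdd_op Z"
    unfolding bdd_op_def using Z0 by (auto simp: Z_def intro!: exI[of _ 0])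
  moreover have HZ: "?H \<gamma> - Z = ?H \<gamma>" for \<gamma> by (simp add: Z_def fun_eq_iff)
  ultimately have "continuous_map (S_topology r) euclideanreal (\<lambda>\<gamma>. op_norm r ?V U (?H \<gamma>))"
    using cont[of Z] by simp
  \<comment> \<open>Adding 1 makes the constant positive even where the operator vanishes, and
    preserves continuity in \<gamma>.\<close>
  then have part2: "continuous_map (S_topology r) euclideanreal (\<lambda>\<gamma>. op_norm r ?V U (?H \<gamma>) + 1)"
    by (intro continuous_intros)
  have bound2: "op_norm r ?V U (?H \<gamma>) + 1 > 0"
      "poly q \<in> O_space r \<Longrightarrow>
        Linf_norm U (?H \<gamma> (poly q)) \<le> (op_norm r ?V U (?H \<gamma>) + 1) * Linf_norm ?V (poly q)"
    if \<gamma>: "\<gamma> \<in> S_space r" for \<gamma> q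
  proof -
    show "op_norm r ?V U (?H \<gamma>) + 1 > 0" using op_norm_nonneg[OF Hb[OF \<gamma>]] by simp
    assume q: "poly q \<in> O_space r"
    show "Linf_norm U (?H \<gamma> (poly q)) \<le> (op_norm r ?V U (?H \<gamma>) + 1) * Linf_norm ?V (poly q)"
      using le_op_norm[OF Hb[OF \<gamma>] q] V_nonneg[OF q] by (simp add: distrib_right)
  qed
  have self: "op_norm r ?V U (T - T) = 0" for T
  proof -
    have "op_norm r ?V U (T - T) = op_norm r ?V U Z" by (simp add: Z_def fun_eq_iff fun_diff_def)
    also have "O_space r \<noteq> {}" using zero_in_O_space by blast
    then have "op_norm r ?V U Z = 0" unfolding op_norm_def Z0 by simp
    finally show ?thesis .
  qed
  have part3: "continuous_map (S_topology r) (op_topology r ?V U) ?H"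
    unfolding op_topology_def seminorm_topology_def
  proof (rule continuous_on_generated_topo)
    fix G assume "G \<in> {{y \<in> bounded_ops r ?V U. p (y - x) < e} |p x e.
        p \<in> {op_norm r ?V U} \<and> x \<in> bounded_ops r ?V U \<and> 0 < e}"
    then obtain T e where G: "G = {y \<in> bounded_ops r ?V U. op_norm r ?V U (y - T) < e}"
        "T \<in> bounded_ops r ?V U" by blast
    have "openin (S_topology r) {\<gamma> \<in> topspace (S_topology r). op_norm r ?V U (?H \<gamma> - T) \<in> {..<e}}"
      using cont[OF bounded_ops_imp_bdd_op[OF G(2)]]
      by (rule openin_continuous_map_preimage) simp
    moreover have "{\<gamma> \<in> topspace (S_topology r). op_norm r ?V U (?H \<gamma> - T) \<in> {..<e}} =
        ?H -` G \<inter> topspace (S_topology r)"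
      using H by (auto simp: G(1) top)
    ultimately show "openin (S_topology r) (?H -` G \<inter> topspace (S_topology r))" by simp
  next
    show "?H ` topspace (S_topology r) \<subseteq> \<Union> {{y \<in> bounded_ops r ?V U. p (y - x) < e} |p x e.
        p \<in> {op_norm r ?V U} \<and> x \<in> bounded_ops r ?V U \<and> 0 < e}"
    proof
      fix T assume "T \<in> ?H ` topspace (S_topology r)"
      then have T: "T \<in> bounded_ops r ?V U" using H by (auto simp: top)
      then have "T \<in> {y \<in> bounded_ops r ?V U. op_norm r ?V U (y - T) < 1}" using self by simp
      with T show "T \<in> \<Union> {{y \<in> bounded_ops r ?V U. p (y - x) < e} |p x e.
        p \<in> {op_norm r ?V U} \<and> x \<in> bounded_ops r ?V U \<and> 0 < e}"
        using zero_less_one by blast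
    qed
  qed
  show ?thesis
  proof (intro conjI ballI)
    fix \<gamma> assume "\<gamma> \<in> S_space r"
    from bound2[OF this] show "\<exists>C>0. \<forall>q :: complex poly. poly q \<in> O_space r \<longrightarrow>
        Linf_norm U (?H \<gamma> (poly q)) \<le> C * Linf_norm ?V (poly q)" by blast
  next
    show "\<exists>C. continuous_map (S_topology r) euclideanreal C \<and>
        (\<forall>\<gamma>\<in>S_space r. C \<gamma> > 0 \<and> (\<forall>q :: complex poly. poly q \<in> O_space r \<longrightarrow>
          Linf_norm U (?H \<gamma> (poly q)) \<le> C \<gamma> * Linf_norm ?V (poly q)))"
      by (intro exI[of _ "\<lambda>\<gamma>. op_norm r ?V U (?H \<gamma>) + 1"] conjI ballI allI impI part2 bound2)
  qed (rule part3)
qed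

end
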